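(* Let $\mathfrak{N}$ be the set of normal monomial ideals of finite colength in $\mathbb{C}[x,y]$. Then every $I\in\mathfrak{N}$ factors as a product of ideals in $\mathfrak{N}$, $$I=\prod_{k=1}^{t}\mathfrak{n}_{\alpha_k,\beta_k}^{\delta_k},$$ where $\alpha_k,\beta_k\geq 1$, $\delta_k\geq1$ and $\gcd(\alpha_k,\beta_k)=1$ for $k=1,\ldots,t$, and the pairs $(\alpha_k,\beta_k)$ are pairwise distinct. Such a factorisation is unique up to reordering the factors.
   Context: For a monomial ideal $I\subset\mathbb{C}[x,y]$ of finite colength (i.e. $\dim_{\mathbb{C}}\mathbb{C}[x,y]/I<\infty$), its normalisation is the monomial ideal $\overline{I}$ generated by all monomials $x^ay^b$ such that $(x^ay^b)^p\in I^p$ for some $p\geq1$. The ideal $I$ is called normal if its Rees algebra $\bigoplus_{i\geq0}I^it^i\subset\mathbb{C}[x,y][t]$ is a normal domain (equivalently, $\operatorname{Bl}_I\mathbb{A}^2$ is normal, equivalently $I=\overline{I}$). For positive integers $h,k$, $\mathfrak{n}_{h,k}$ denotes the normalisation of the ideal $(x^h,y^k)$. An empty product of ideals is the unit ideal. *)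

theory Defs
  imports
    "HOL-Algebra.Algebraic_Closure_Type"
    "HOL-Algebra.Ideal_Product"
    "HOL-Algebra.QuotRing"
begin

text \<open>
  \<open>\<complex>[x,y]\<close> is \<open>complex poly poly\<close>, i.e. \<open>\<complex>[x][y]\<close>: the inner indeterminate is \<open>x\<close>, the outer one
  is \<open>y\<close>. Likewise \<open>\<complex>[x,y][t]\<close> is \<open>complex poly poly poly\<close>.
\<close>

abbreviation cxy :: "complex poly poly ring"
  where "cxy \<equiv> ring_of_type_algebra"

definition xymonom :: "nat \<Rightarrow> nat \<Rightarrow> complex poly poly"
  where "xymonom a b = Polynomial.monom (Polynomial.monom 1 a) b"

definition cscale :: "complex \<Rightarrow> complex poly poly \<Rightarrow> complex poly poly"
  where "cscale c f = Polynomial.smult [:c:] f"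

lemma vector_space_cscale: "vector_space cscale"
  by unfold_locales
    (simp_all add: cscale_def smult_add_right mult.commute flip: one_pCons smult_add_left)

text \<open>\<open>I ^ i\<close> in the monoid of ideals; in particular \<open>I ^ 0\<close> is the unit ideal.\<close>

abbreviation ideal_pow :: "complex poly poly set \<Rightarrow> nat \<Rightarrow> complex poly poly set"
  where "ideal_pow I i \<equiv> I [^]\<^bsub>ideals_set cxy\<^esub> i"

definition monomial_ideal :: "complex poly poly set \<Rightarrow> bool"
  where "monomial_ideal I \<longleftrightarrow> (\<exists>S. I = Idl\<^bsub>cxy\<^esub> (case_prod xymonom ` S))"

text \<open>The quotient vector space \<open>\<complex>[x,y]/I\<close> is spanned by the classes of finitely many elements.\<close>

definition finite_colength :: "complex poly poly set \<Rightarrow> bool"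
  where "finite_colength I \<longleftrightarrow>
    (\<exists>B. finite B \<and> carrier (cxy Quot I) = (\<lambda>f. I +>\<^bsub>cxy\<^esub> f) ` module.span cscale B)"

definition normalisation :: "complex poly poly set \<Rightarrow> complex poly poly set"
  where "normalisation I = Idl\<^bsub>cxy\<^esub> {xymonom a b | a b. \<exists>p\<ge>1. xymonom a b ^ p \<in> ideal_pow I p}"

definition integral_over :: "'b::comm_ring_1 set \<Rightarrow> 'b \<Rightarrow> bool"
  where "integral_over A z \<longleftrightarrow>
    (\<exists>p. lead_coeff p = 1 \<and> set (coeffs p) \<subseteq> A \<and> poly p z = 0)"

text \<open>
  For a subring \<open>A\<close> of an integral domain, the field of fractions of \<open>A\<close> is realised inside that of
  the ambient domain.
\<close>

definition fractions :: "'a::idom set \<Rightarrow> 'a fract set"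
  where "fractions A = {to_fract a / to_fract b | a b. a \<in> A \<and> b \<in> A \<and> b \<noteq> 0}"

definition normal_domain :: "'a::idom set \<Rightarrow> bool"
  where "normal_domain A \<longleftrightarrow> subdomain A ring_of_type_algebra \<and>
    (\<forall>z\<in>fractions A. integral_over (to_fract ` A) z \<longrightarrow> z \<in> to_fract ` A)"

definition rees_algebra :: "complex poly poly set \<Rightarrow> complex poly poly poly set"
  where "rees_algebra I = {F. \<forall>i. Polynomial.coeff F i \<in> ideal_pow I i}"

definition normal_monomial_ideals :: "complex poly poly set set" (\<open>\<NN>\<close>)
  where "\<NN> = {I. monomial_ideal I \<and> finite_colength I \<and> normal_domain (rees_algebra I)}"

definition nn :: "nat \<Rightarrow> nat \<Rightarrow> complex poly poly set" (\<open>\<nn>\<close>)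
  where "\<nn> h k = normalisation (Idl\<^bsub>cxy\<^esub> {xymonom h 0, xymonom 0 k})"

definition is_factorisation ::
    "complex poly poly set \<Rightarrow> nat \<Rightarrow> (nat \<Rightarrow> nat) \<Rightarrow> (nat \<Rightarrow> nat) \<Rightarrow> (nat \<Rightarrow> nat) \<Rightarrow> bool"
  where "is_factorisation I t \<alpha> \<beta> \<delta> \<longleftrightarrow>
    (\<forall>k\<in>{1..t}. \<alpha> k \<ge> 1 \<and> \<beta> k \<ge> 1 \<and> \<delta> k \<ge> 1 \<and> gcd (\<alpha> k) (\<beta> k) = 1) \<and>
    inj_on (\<lambda>k. (\<alpha> k, \<beta> k)) {1..t} \<and>
    I = (\<Otimes>\<^bsub>ideals_set cxy\<^esub> k\<in>{1..t}. ideal_pow (\<nn> (\<alpha> k) (\<beta> k)) (\<delta> k))"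

end

theory Submission
  imports
    Defs
    "HOL-Library.Set_Algebras"
    "HOL-Library.Product_Plus"
    "HOL-Computational_Algebra.Field_as_Ring"
begin

text \<open>
  A monomial ideal of \<open>\<complex>[x,y]\<close> is the span of the monomials with exponents in an up-closed set
  \<open>E \<subseteq> \<nat>\<^sup>2\<close>, and products of ideals become Minkowski sums of exponent sets. Normality of the
  Rees algebra forces \<open>E\<close> to be closed under convex combinations, so that \<open>E\<close> consists of the
  lattice points of its Newton polygon. For coprime \<open>h, k\<close> the exponent set of
  \<open>\<nn> h k\<close> is the region on and above the primitive segment from \<open>(0, k)\<close> to \<open>(h, 0)\<close>. The
  factorisation is therefore the decomposition of the boundary of a convex lattice polygon into
  primitive edges: the direction of an edge gives the pair \<open>(\<alpha>, \<beta>)\<close>, and its lattice length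
  gives \<open>\<delta>\<close>.

  For existence, one primitive segment of the steepest edge, the one that starts on the \<open>y\<close>-axis,
  is split off (\<open>split_first_edge\<close>). The colon ideal of \<open>I\<close> by the corresponding power of
  \<open>x\<close> is again convex and meets the \<open>y\<close>-axis lower down, so induction on that height applies
  (\<open>exists_factorisation\<close>).

  For uniqueness, the support function \<open>(u, v) \<mapsto> min {u a + v b | (a, b) \<in> E}\<close> is additive
  under Minkowski sums and equals \<open>min (u \<alpha>) (v \<beta>)\<close> for \<open>\<nn> \<alpha> \<beta>\<close>. A product thus has support
  function \<open>\<Sum>\<^sub>k \<delta>\<^sub>k min (u \<alpha>\<^sub>k) (v \<beta>\<^sub>k)\<close>, which is piecewise linear with a kink exactly along
  the rays \<open>u \<alpha>\<^sub>k = v \<beta>\<^sub>k\<close>; the size of the kink, a second difference, recovers \<open>\<delta>\<^sub>k\<close>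
  (\<open>multiplicity_from_support\<close>).

  That the factors are normal (\<open>nn_in_NN\<close>) holds because the Rees algebra of \<open>\<nn> h k\<close> is the ring
  of non-negative elements for the monomial valuation on \<open>\<complex>[x,y,t]\<close> with weights \<open>k\<close>, \<open>h\<close>,
  \<open>- h k\<close>. An element of the fraction field that is integral over it lies in the gcd domain
  \<open>\<complex>[x,y,t]\<close>, and comparing valuations in the integral equation shows that it is non-negative.
\<close>

section \<open>Monomial ideals and exponent sets\<close>

definition monspan :: "(nat \<times> nat) set \<Rightarrow> complex poly poly set"
  where "monspan E = {f. \<forall>a b. Polynomial.coeff (Polynomial.coeff f b) a \<noteq> 0 \<longrightarrow> (a, b) \<in> E}"

definition up_closed :: "(nat \<times> nat) set \<Rightarrow> bool"
  where "up_closed E \<longleftrightarrow> (\<forall>a b c d. (a, b) \<in> E \<longrightarrow> a \<le> c \<longrightarrow> b \<le> d \<longrightarrow> (c, d) \<in> E)"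

definition exponents :: "complex poly poly set \<Rightarrow> (nat \<times> nat) set"
  where "exponents I = {(a, b). xymonom a b \<in> I}"

text \<open>
  These equations translate the record operations of a type-based ring into the operators of the
  type, so that ideals can be handled by the simplifier.
\<close>

lemma type_ring_simps [simp]:
  "carrier (ring_of_type_algebra :: 'a::comm_ring_1 ring) = UNIV"
  "monoid.mult (ring_of_type_algebra :: 'a ring) = (*)"
  "monoid.one (ring_of_type_algebra :: 'a ring) = 1"
  "ring.zero (ring_of_type_algebra :: 'a ring) = 0"
  "ring.add (ring_of_type_algebra :: 'a ring) = (+)"
  by (simp_all add: ring_of_type_algebra_def)

interpretation cxy: cring cxy
  rewrites "carrier cxy = UNIV" and "monoid.mult cxy = (*)" and "monoid.one cxy = 1"
    and "ring.zero cxy = 0" and "ring.add cxy = (+)"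
  by (simp_all add: cring_from_type_algebra)

interpretation ideals: comm_monoid "ideals_set cxy"
  using cring_from_type_algebra by (rule cring.ideals_set_is_comm_monoid)

lemma ideals_set_simps [simp]:
  "I \<in> carrier (ideals_set R) \<longleftrightarrow> ideal I R"
  "monoid.mult (ideals_set R) = ideal_prod R"
  "monoid.one (ideals_set R) = carrier R"
  by (simp_all add: ideals_set_def)

lemma ideal_cxy_iff:
  "ideal I cxy \<longleftrightarrow> 0 \<in> I \<and> (\<forall>f\<in>I. \<forall>g\<in>I. f + g \<in> I) \<and> (\<forall>f\<in>I. \<forall>g. g * f \<in> I)"
proof
  assume "ideal I cxy"
  then interpret ideal I cxy .
  show "0 \<in> I \<and> (\<forall>f\<in>I. \<forall>g\<in>I. f + g \<in> I) \<and> (\<forall>f\<in>I. \<forall>g. g * f \<in> I)"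
    using zero_closed a_closed I_l_closed by simp
next
  assume *: "0 \<in> I \<and> (\<forall>f\<in>I. \<forall>g\<in>I. f + g \<in> I) \<and> (\<forall>f\<in>I. \<forall>g. g * f \<in> I)"
  have neg: "\<ominus>\<^bsub>cxy\<^esub> f = - f" for f
    using cring.sum_zero_eq_neg[of cxy "-f" f] cring_from_type_algebra
    by (auto intro!: cxy.minus_equality)
  have "- f \<in> I" if "f \<in> I" for f
    using * that by (metis mult_minus1)
  then have "inv\<^bsub>add_monoid cxy\<^esub> f \<in> I" if "f \<in> I" for f
    using neg[of f] that by (simp only: a_inv_def)
  then have "subgroup I (add_monoid cxy)"
    using * by (intro subgroup.intro) (auto simp del: type_ring_simps(5), simp_all)
  then show "ideal I cxy"
    using * by (intro idealI) (auto simp: ring_from_type_algebra mult.commute)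
qed

lemma ideal_sum:
  assumes "ideal I cxy" "\<And>i. i \<in> A \<Longrightarrow> f i \<in> I"
  shows "sum f A \<in> I"
  using assms by (induction A rule: infinite_finite_induct) (auto simp: ideal_cxy_iff)

lemma coeff_xymonom:
  "Polynomial.coeff (Polynomial.coeff (xymonom a b) d) c = (if a = c \<and> b = d then 1 else 0)"
  by (auto simp: xymonom_def)

lemma xymonom_mult: "xymonom a b * xymonom c d = xymonom (a + c) (b + d)"
  by (simp add: xymonom_def mult_monom)

lemma xymonom_0 [simp]: "xymonom 0 0 = 1"
  by (simp add: xymonom_def monom_0 one_pCons)

lemma xymonom_power: "xymonom a b ^ n = xymonom (n * a) (n * b)"
  by (induction n) (auto simp: xymonom_mult)

lemma monom_sum: "Polynomial.monom (sum f A) n = (\<Sum>i\<in>A. Polynomial.monom (f i) n)"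
  by (intro poly_eqI) (simp add: coeff_sum)

lemma xymonom_expansion:
  "f = (\<Sum>b\<le>Polynomial.degree f. \<Sum>a\<le>Polynomial.degree (Polynomial.coeff f b).
          [:[:Polynomial.coeff (Polynomial.coeff f b) a:]:] * xymonom a b)"
proof -
  have "Polynomial.monom (Polynomial.coeff f b) b =
      (\<Sum>a\<le>Polynomial.degree (Polynomial.coeff f b).
          [:[:Polynomial.coeff (Polynomial.coeff f b) a:]:] * xymonom a b)" for b
  proof -
    have "Polynomial.monom (Polynomial.coeff f b) b = Polynomial.monom
       (\<Sum>a\<le>Polynomial.degree (Polynomial.coeff f b). Polynomial.monom (Polynomial.coeff (Polynomial.coeff f b) a) a) b"
      by (simp add: poly_as_sum_of_monoms)
    also have "\<dots> = (\<Sum>a\<le>Polynomial.degree (Polynomial.coeff f b).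
        Polynomial.monom (Polynomial.monom (Polynomial.coeff (Polynomial.coeff f b) a) a) b)"
      by (simp add: monom_sum)
    finally show ?thesis
      by (simp add: xymonom_def smult_monom)
  qed
  then show ?thesis
    using poly_as_sum_of_monoms[of f] by simp
qed

text \<open>
  Every polynomial is a finite combination of its monomials, so an ideal that contains the
  monomials of \<open>E\<close> contains their whole span.
\<close>

lemma monspan_subset_ideal:
  assumes "ideal I cxy" and "\<And>a b. (a, b) \<in> E \<Longrightarrow> xymonom a b \<in> I"
  shows "monspan E \<subseteq> I"
proof
  fix f assume f: "f \<in> monspan E"
  have "[:[:Polynomial.coeff (Polynomial.coeff f b) a:]:] * xymonom a b \<in> I" for a b
  proof (cases "Polynomial.coeff (Polynomial.coeff f b) a = 0")
    case True
    then show ?thesis using assms(1) by (simp add: ideal_cxy_iff)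
  next
    case False
    then show ?thesis using assms f unfolding ideal_cxy_iff monspan_def by blast
  qed
  then show "f \<in> I"
    by (subst xymonom_expansion) (intro ideal_sum assms)
qed

lemma xymonom_in_monspan [simp]: "xymonom a b \<in> monspan E \<longleftrightarrow> (a, b) \<in> E"
  by (auto simp: monspan_def coeff_xymonom)

lemma exponents_monspan [simp]: "exponents (monspan E) = E"
  by (auto simp: exponents_def)

lemma monspan_inject: "monspan E = monspan F \<longleftrightarrow> E = F"
  by (metis exponents_monspan)

lemma monspan_UNIV: "monspan UNIV = UNIV"
  by (auto simp: monspan_def)

lemma monspan_mult:
  assumes "f \<in> monspan E" "g \<in> monspan F"
  shows "f * g \<in> monspan (E + F)"
  unfolding monspan_def
proof (intro CollectI allI impI)
  fix a b
  assume "Polynomial.coeff (Polynomial.coeff (f * g) b) a \<noteq> 0"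
  then obtain i j where "i \<le> a" "j \<le> b"
    and nz: "Polynomial.coeff (Polynomial.coeff f j) i * Polynomial.coeff (Polynomial.coeff g (b - j)) (a - i) \<noteq> 0"
    unfolding coeff_mult coeff_sum
    by (elim sum.not_neutral_contains_not_neutral) (auto simp: coeff_mult)
  from nz assms have "(i, j) \<in> E" "(a - i, b - j) \<in> F"
    by (auto simp: monspan_def)
  then have "(i, j) + (a - i, b - j) \<in> E + F" by (rule set_plus_intro)
  then show "(a, b) \<in> E + F" using \<open>i \<le> a\<close> \<open>j \<le> b\<close> by simp
qed

lemma up_closedD: "up_closed E \<Longrightarrow> (a, b) \<in> E \<Longrightarrow> a \<le> c \<Longrightarrow> b \<le> d \<Longrightarrow> (c, d) \<in> E"
  by (auto simp: up_closed_def)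

lemma UNIV_plus_up_closed:
  assumes "up_closed E"
  shows "UNIV + E = E"
proof
  show "UNIV + E \<subseteq> E"
    using assms by (auto simp: set_plus_def intro: up_closedD)
  have "(0, 0) + p \<in> UNIV + E" if "p \<in> E" for p
    using that by (intro set_plus_intro) auto
  then show "E \<subseteq> UNIV + E" by (auto simp flip: zero_prod_def)
qed

lemma up_closed_plus:
  assumes "up_closed E"
  shows "up_closed (E + F)"
  unfolding up_closed_def
proof (intro allI impI)
  fix a b c d :: nat
  assume *: "(a, b) \<in> E + F" "a \<le> c" "b \<le> d"
  then obtain a1 b1 a2 b2 where 1: "(a1, b1) \<in> E" "(a2, b2) \<in> F" "a = a1 + a2" "b = b1 + b2"
    by (auto simp: set_plus_def)
  with * have "(a1 + (c - a), b1 + (d - b)) + (a2, b2) \<in> E + F"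
    by (intro set_plus_intro) (auto intro: up_closedD[OF assms])
  then show "(c, d) \<in> E + F" using * 1 by simp
qed

lemma ideal_monspan: 
  assumes "up_closed E"
  shows "ideal (monspan E) cxy"
  unfolding ideal_cxy_iff
proof (intro conjI ballI allI)
  show "g * f \<in> monspan E" if "f \<in> monspan E" for f g
    using monspan_mult[of g UNIV f E] that by (simp add: monspan_UNIV UNIV_plus_up_closed assms)
  show "f + g \<in> monspan E" if "f \<in> monspan E" "g \<in> monspan E" for f g
    using that unfolding monspan_def by simp (metis add.right_neutral)
qed (auto simp: monspan_def)

text \<open>
  This turns the multiplicative monoid of monomial ideals into the additive monoid of up-closed
  sets: exponents add under multiplication, so no monomial outside \<open>E + F\<close> can occur in a product,
  and each monomial of \<open>E + F\<close> is itself a product.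
\<close>

lemma ideal_prod_monspan:
  assumes "up_closed E" "up_closed F"
  shows "ideal_prod cxy (monspan E) (monspan F) = monspan (E + F)"
proof
  have id: "ideal (monspan (E + F)) cxy"
    using assms by (intro ideal_monspan up_closed_plus)
  show "ideal_prod cxy (monspan E) (monspan F) \<subseteq> monspan (E + F)"
  proof
    fix f assume "f \<in> ideal_prod cxy (monspan E) (monspan F)"
    then show "f \<in> monspan (E + F)"
      using id by induction (auto simp: monspan_mult ideal_cxy_iff)
  qed
  have "xymonom a b \<in> ideal_prod cxy (monspan E) (monspan F)" if "(a, b) \<in> E + F" for a b
  proof -
    from that obtain a1 b1 a2 b2 where 1: "(a1, b1) \<in> E" "(a2, b2) \<in> F" "a = a1 + a2" "b = b1 + b2"
      by (auto simp: set_plus_def)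
    then have "xymonom a1 b1 \<otimes>\<^bsub>cxy\<^esub> xymonom a2 b2 \<in> ideal_prod cxy (monspan E) (monspan F)"
      by (intro ideal_prod.prod) auto
    then show ?thesis using 1 by (simp add: xymonom_mult)
  qed
  then show "monspan (E + F) \<subseteq> ideal_prod cxy (monspan E) (monspan F)"
    using assms by (intro monspan_subset_ideal cxy.ideal_prod_is_ideal ideal_monspan)
qed

lemma up_closed_exponents: "ideal I cxy \<Longrightarrow> up_closed (exponents I)"
  unfolding up_closed_def exponents_def ideal_cxy_iff
  by clarsimp (metis xymonom_mult le_add_diff_inverse2)

text \<open>
  A generating set of monomials lies in \<open>monspan (exponents I)\<close>, which is an ideal and hence
  contains everything that they generate.
\<close>

lemma monomial_ideal_eq_monspan:
  assumes "monomial_ideal I"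
  shows "I = monspan (exponents I)" and "ideal I cxy"
proof -
  obtain S where S: "I = Idl\<^bsub>cxy\<^esub> (case_prod xymonom ` S)"
    using assms by (auto simp: monomial_ideal_def)
  show I: "ideal I cxy"
    unfolding S by (rule cxy.genideal_ideal) simp
  have "case_prod xymonom ` S \<subseteq> I"
    unfolding S by (rule cxy.genideal_self) simp
  then have "I \<subseteq> monspan (exponents I)"
    by (subst S, intro cxy.genideal_minimal ideal_monspan up_closed_exponents I)
      (auto simp: exponents_def)
  moreover have "monspan (exponents I) \<subseteq> I"
    using I by (rule monspan_subset_ideal) (auto simp: exponents_def)
  ultimately show "I = monspan (exponents I)" by auto
qed

lemma monomial_ideal_monspan:
  assumes "up_closed E"
  shows "monspan E = Idl\<^bsub>cxy\<^esub> (case_prod xymonom ` E)" and "monomial_ideal (monspan E)"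
proof -
  show "monspan E = Idl\<^bsub>cxy\<^esub> (case_prod xymonom ` E)"
  proof
    show "monspan E \<subseteq> Idl\<^bsub>cxy\<^esub> (case_prod xymonom ` E)"
      using cxy.genideal_self[of "case_prod xymonom ` E"]
      by (intro monspan_subset_ideal cxy.genideal_ideal) auto
    show "Idl\<^bsub>cxy\<^esub> (case_prod xymonom ` E) \<subseteq> monspan E"
      by (intro cxy.genideal_minimal ideal_monspan assms) auto
  qed
  then show "monomial_ideal (monspan E)" by (auto simp: monomial_ideal_def)
qed

section \<open>Powers of ideals\<close>

lemma ideal_ideal_pow: "ideal I cxy \<Longrightarrow> ideal (ideal_pow I n) cxy"
  using ideals.nat_pow_closed[of I n] by simp

lemma ideal_pow_1: "ideal I cxy \<Longrightarrow> ideal_pow I 1 = I"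
  by (intro ideals.nat_pow_eone) simp

lemma ideal_pow_mult_mem:
  assumes "ideal I cxy" "f \<in> ideal_pow I m" "g \<in> ideal_pow I n"
  shows "f * g \<in> ideal_pow I (m + n)"
proof -
  have "f \<otimes>\<^bsub>cxy\<^esub> g \<in> ideal_prod cxy (ideal_pow I m) (ideal_pow I n)"
    using assms by (intro ideal_prod.prod)
  then show ?thesis
    using ideals.nat_pow_mult[of I m n] assms by simp
qed

lemma power_mem_ideal_pow:
  assumes "ideal I cxy" "f \<in> I"
  shows "f ^ n \<in> ideal_pow I n"
proof (induction n)
  case (Suc n)
  have "f ^ n * f \<in> ideal_pow I (n + 1)"
    using assms Suc ideal_pow_1[of I] by (intro ideal_pow_mult_mem) simp_all
  then show ?case by (simp add: mult.commute)
qed simp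

lemma ideal_prod_mono:
  assumes "I \<subseteq> I'" "J \<subseteq> J'"
  shows "ideal_prod R I J \<subseteq> ideal_prod R I' J'"
proof
  fix f assume "f \<in> ideal_prod R I J"
  then show "f \<in> ideal_prod R I' J'"
    by induction (use assms in \<open>auto intro: ideal_prod.intros\<close>)
qed

lemma ideal_pow_mono: "I \<subseteq> J \<Longrightarrow> ideal_pow I n \<subseteq> ideal_pow J n"
  by (induction n) (simp_all add: ideal_prod_mono)

section \<open>The exponent sets of the ideals n(h,k) and of their powers\<close>

text \<open>
  The lattice points on or above the segment from \<open>(0, i k)\<close> to \<open>(i h, 0)\<close>.
\<close>

definition wedge :: "nat \<Rightarrow> nat \<Rightarrow> nat \<Rightarrow> (nat \<times> nat) set"
  where "wedge h k i = {(a, b). i * (h * k) \<le> k * a + h * b}"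

lemma up_closed_wedge: "up_closed (wedge h k i)"
  unfolding up_closed_def wedge_def
  by clarsimp (meson add_mono le_trans mult_le_mono2)

text \<open>
  For \<open>i \<ge> 1\<close>, a point of weight \<open>k a + h b \<ge> (i + 1) h k\<close> has \<open>a \<ge> h\<close> or \<open>b \<ge> k\<close>, since otherwise
  its weight is below \<open>2 h k\<close>. Hence one of the two corners \<open>(h, 0)\<close> and \<open>(0, k)\<close> can be split
  off, which lowers the weight by exactly \<open>h k\<close>.
\<close>

lemma wedge_plus_wedge: "wedge h k i + wedge h k 1 = wedge h k (Suc i)"
proof
  show "wedge h k i + wedge h k 1 \<subseteq> wedge h k (Suc i)"
    by (auto simp: wedge_def set_plus_def algebra_simps)
  show "wedge h k (Suc i) \<subseteq> wedge h k i + wedge h k 1"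
  proof clarify
    fix a b assume ab: "(a, b) \<in> wedge h k (Suc i)"
    consider "a \<ge> h" | "b \<ge> k" | "a < h" "b < k" by linarith
    then show "(a, b) \<in> wedge h k i + wedge h k 1"
    proof cases
      case 1
      then obtain c where c: "a = c + h" by (metis add.commute le_Suc_ex)
      have "(c, b) + (h, 0) \<in> wedge h k i + wedge h k 1"
        using ab c by (intro set_plus_intro) (auto simp: wedge_def algebra_simps)
      then show ?thesis using c by simp
    next
      case 2
      then obtain c where c: "b = c + k" by (metis add.commute le_Suc_ex)
      have "(a, c) + (0, k) \<in> wedge h k i + wedge h k 1"
        using ab c by (intro set_plus_intro) (auto simp: wedge_def algebra_simps)
      then show ?thesis using c by simp
    next
      case 3
      have "Suc i * (h * k) \<le> k * a + h * b" using ab by (simp add: wedge_def)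
      also have "\<dots> < h * k + h * k"
        using 3 by (intro add_less_le_mono) auto
      finally have "i = 0"
        by (cases i) (auto simp: algebra_simps)
      have "(0, 0) + (a, b) \<in> wedge h k i + wedge h k 1"
        using ab \<open>i = 0\<close> by (intro set_plus_intro) (auto simp: wedge_def)
      then show ?thesis by simp
    qed
  qed
qed

lemma ideal_pow_wedge: "ideal_pow (monspan (wedge h k 1)) i = monspan (wedge h k i)"
proof (induction i)
  case 0
  have "wedge h k 0 = UNIV" by (auto simp: wedge_def)
  then show ?case by (simp add: monspan_UNIV)
next
  case (Suc i)
  then show ?case
    using wedge_plus_wedge[of h k i] by (simp add: ideal_prod_monspan up_closed_wedge)
qed

text \<open>
  The weight \<open>k a + h b\<close> is at least \<open>p h k\<close> on all monomials of the \<open>p\<close>-th power of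
  \<open>(x\<^sup>h, y\<^sup>k)\<close>, which bounds the normalisation from above. Conversely, for a point of the wedge the
  exponent \<open>p = h k\<close> always suffices.
\<close>

lemma nn_eq_monspan:
  assumes "h \<ge> 1" "k \<ge> 1"
  shows "\<nn> h k = monspan (wedge h k 1)"
proof -
  define J where "J = Idl\<^bsub>cxy\<^esub> {xymonom h 0, xymonom 0 k}"
  have J: "ideal J cxy" "xymonom h 0 \<in> J" "xymonom 0 k \<in> J"
    unfolding J_def using cxy.genideal_self[of "{xymonom h 0, xymonom 0 k}"]
    by (auto intro: cxy.genideal_ideal)
  have "J \<subseteq> monspan (wedge h k 1)"
    unfolding J_def
    by (intro cxy.genideal_minimal ideal_monspan up_closed_wedge) (auto simp: wedge_def)
  then have sub: "ideal_pow J p \<subseteq> monspan (wedge h k p)" for p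
    using ideal_pow_mono ideal_pow_wedge by metis
  have "(\<exists>p\<ge>1. xymonom a b ^ p \<in> ideal_pow J p) \<longleftrightarrow> (a, b) \<in> wedge h k 1" for a b
  proof
    assume "\<exists>p\<ge>1. xymonom a b ^ p \<in> ideal_pow J p"
    then obtain p where p: "p \<ge> 1" "xymonom (p * a) (p * b) \<in> ideal_pow J p"
      by (auto simp: xymonom_power)
    then have "(p * a, p * b) \<in> wedge h k p"
      using sub by (metis subsetD xymonom_in_monspan)
    then have "p * (h * k) \<le> p * (k * a + h * b)"
      by (simp add: wedge_def algebra_simps)
    with p show "(a, b) \<in> wedge h k 1" by (simp add: wedge_def)
  next
    assume ab: "(a, b) \<in> wedge h k 1"
    define p where "p = h * k"
    \<comment> \<open>\<open>x\<^sup>h\<close> is used as often as it fits into \<open>x\<close>-degree \<open>p a = h (k a)\<close>, at most \<open>p\<close> times.\<close>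
    define i where "i = min (k * a) p"
    have i: "i \<le> p" "h * i \<le> p * a" "k * (p - i) \<le> p * b"
    proof -
      show "h * i \<le> p * a" by (auto simp: i_def p_def)
      have "p - i \<le> h * b" using ab by (auto simp: wedge_def i_def p_def)
      then have "k * (p - i) \<le> k * (h * b)" by (rule mult_le_mono2)
      then show "k * (p - i) \<le> p * b" by (simp add: p_def algebra_simps)
    qed (simp add: i_def)
    have "xymonom h 0 ^ i * xymonom 0 k ^ (p - i) \<in> ideal_pow J (i + (p - i))"
      by (intro ideal_pow_mult_mem power_mem_ideal_pow J)
    then have "xymonom (h * i) (k * (p - i)) \<in> ideal_pow J p"
      using i by (simp add: xymonom_power xymonom_mult mult.commute)
    then have "(h * i, k * (p - i)) \<in> exponents (ideal_pow J p)"
      by (simp add: exponents_def)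
    then have "(p * a, p * b) \<in> exponents (ideal_pow J p)"
      using up_closed_exponents[OF ideal_ideal_pow[OF J(1)]] i by (blast intro: up_closedD)
    then have "xymonom a b ^ p \<in> ideal_pow J p"
      by (simp add: exponents_def xymonom_power)
    then show "\<exists>p\<ge>1. xymonom a b ^ p \<in> ideal_pow J p"
      using assms by (intro exI[of _ p]) (auto simp: p_def)
  qed
  then have "{xymonom a b | a b. \<exists>p\<ge>1. xymonom a b ^ p \<in> ideal_pow J p} = case_prod xymonom ` wedge h k 1"
    by auto
  then show ?thesis
    unfolding nn_def normalisation_def J_def[symmetric]
    using monomial_ideal_monspan(1)[OF up_closed_wedge] by simp
qed

lemma ideal_nn: "h \<ge> 1 \<Longrightarrow> k \<ge> 1 \<Longrightarrow> ideal (\<nn> h k) cxy"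
  by (simp add: nn_eq_monspan ideal_monspan up_closed_wedge)

section \<open>Finite colength\<close>

lemma range_eq_image_iff: "range F = F ` S \<longleftrightarrow> (\<forall>x. \<exists>y\<in>S. F x = F y)"
  by blast

lemma finite_colength_iff_approx:
  assumes "ideal I cxy"
  shows "finite_colength I \<longleftrightarrow> (\<exists>B. finite B \<and> (\<forall>f. \<exists>g\<in>module.span cscale B. f - g \<in> I))"
proof -
  have coset: "I +>\<^bsub>cxy\<^esub> f = {h + f | h. h \<in> I}" for f
    by (auto simp: a_r_coset_def r_coset_def)
  have neg: "- f \<in> I" if "f \<in> I" for f
    using assms that unfolding ideal_cxy_iff by (metis mult_minus1)
  have coset_eq: "I +>\<^bsub>cxy\<^esub> f = I +>\<^bsub>cxy\<^esub> g \<longleftrightarrow> f - g \<in> I" for f g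
  proof
    assume "I +>\<^bsub>cxy\<^esub> f = I +>\<^bsub>cxy\<^esub> g"
    moreover have "0 + f \<in> I +>\<^bsub>cxy\<^esub> f"
      unfolding coset using assms unfolding ideal_cxy_iff by blast
    ultimately show "f - g \<in> I" unfolding coset by auto
  next
    have sub: "I +>\<^bsub>cxy\<^esub> f \<subseteq> I +>\<^bsub>cxy\<^esub> g" if "f - g \<in> I" for f g
    proof
      fix u assume "u \<in> I +>\<^bsub>cxy\<^esub> f"
      then obtain h where h: "h \<in> I" "u = h + f" unfolding coset by auto
      have "h + (f - g) \<in> I" using assms h that by (auto simp: ideal_cxy_iff)
      moreover have "u = (h + (f - g)) + g" using h by simp
      ultimately show "u \<in> I +>\<^bsub>cxy\<^esub> g" unfolding coset by blast
    qed
    assume "f - g \<in> I"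
    moreover from this have "g - f \<in> I" using neg[of "f - g"] by simp
    ultimately show "I +>\<^bsub>cxy\<^esub> f = I +>\<^bsub>cxy\<^esub> g" using sub by blast
  qed
  have "carrier (cxy Quot I) = range (\<lambda>f. I +>\<^bsub>cxy\<^esub> f)"
    by (auto simp: FactRing_def A_RCOSETS_def')
  then have "carrier (cxy Quot I) = (\<lambda>f. I +>\<^bsub>cxy\<^esub> f) ` module.span cscale B \<longleftrightarrow>
      (\<forall>f. \<exists>g\<in>module.span cscale B. f - g \<in> I)" for B
    unfolding coset_eq[symmetric] by (simp only: range_eq_image_iff)
  then show ?thesis by (simp add: finite_colength_def)
qed

text \<open>
  The monomials outside \<open>E\<close> form a basis of the quotient. For the forward direction it suffices
  that only finitely many exponents occur in a finite set \<open>B\<close>: a monomial \<open>x\<^sup>a y\<^sup>b\<close> with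
  \<open>(a, b) \<notin> E\<close> can only be congruent to an element of the span of \<open>B\<close> in which \<open>(a, b)\<close> occurs.
\<close>

lemma finite_colength_monspan_iff:
  assumes "up_closed E"
  shows "finite_colength (monspan E) \<longleftrightarrow> finite (- E)"
proof
  interpret cs: vector_space cscale by (rule vector_space_cscale)
  have coeff_cscale: "Polynomial.coeff (Polynomial.coeff (cscale c f) b) a =
      c * Polynomial.coeff (Polynomial.coeff f b) a" for c f a b
    by (simp add: cscale_def)
  {
    assume "finite_colength (monspan E)"
    then obtain B where B: "finite B" "\<And>f. \<exists>g\<in>module.span cscale B. f - g \<in> monspan E"
      using assms by (auto simp: finite_colength_iff_approx ideal_monspan)
    define T where "T = (\<Union>f\<in>B. {(a, b). Polynomial.coeff (Polynomial.coeff f b) a \<noteq> 0})"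
    have fin: "finite {(a, b). Polynomial.coeff (Polynomial.coeff f b) a \<noteq> 0}" for f :: "complex poly poly"
    proof (rule finite_subset)
      show "{(a, b). Polynomial.coeff (Polynomial.coeff f b) a \<noteq> 0} \<subseteq>
          (\<Union>b\<le>Polynomial.degree f. {..Polynomial.degree (Polynomial.coeff f b)} \<times> {b})"
        by (auto intro!: le_degree)
    qed auto
    have span: "g \<in> monspan T" if "g \<in> module.span cscale B" for g
    proof -
      have "cs.subspace (monspan T)"
        unfolding cs.subspace_def
        by (auto simp: monspan_def coeff_cscale) (metis add.right_neutral)
      moreover have "B \<subseteq> monspan T" by (auto simp: monspan_def T_def)
      ultimately show ?thesis using that cs.span_minimal by blast
    qed
    have "- E \<subseteq> T"
    proof clarify
      fix a b assume "(a, b) \<notin> E" 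
      obtain g where g: "g \<in> module.span cscale B" "xymonom a b - g \<in> monspan E"
        using B(2) by blast
      with \<open>(a, b) \<notin> E\<close> have "Polynomial.coeff (Polynomial.coeff (xymonom a b - g) b) a = 0"
        by (auto simp: monspan_def)
      then have "Polynomial.coeff (Polynomial.coeff g b) a \<noteq> 0"
        by (simp add: coeff_xymonom)
      then show "(a, b) \<in> T" using span[OF g(1)] by (auto simp: monspan_def)
    qed
    moreover have "finite T" unfolding T_def using B(1) fin by blast
    ultimately show "finite (- E)" by (rule finite_subset)
  }
  {
    assume fin: "finite (- E)"
    define B where "B = case_prod xymonom ` (- E)"
    have "\<exists>g\<in>module.span cscale B. f - g \<in> monspan E" for f
    proof
      define g where "g = (\<Sum>(a, b)\<in>-E. cscale (Polynomial.coeff (Polynomial.coeff f b) a) (xymonom a b))"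
      show "g \<in> module.span cscale B"
        unfolding g_def by (auto simp: B_def intro!: cs.span_sum cs.span_scale intro: cs.span_base)
      have "Polynomial.coeff (Polynomial.coeff g d) c = Polynomial.coeff (Polynomial.coeff f d) c"
        if "(c, d) \<notin> E" for c d
      proof -
        have "Polynomial.coeff (Polynomial.coeff g d) c =
            (\<Sum>p\<in>-E. if p = (c, d) then Polynomial.coeff (Polynomial.coeff f d) c else 0)"
          unfolding g_def coeff_sum
          by (intro sum.cong) (auto simp: coeff_cscale coeff_xymonom split: prod.splits)
        then show ?thesis using that fin by simp
      qed
      then show "f - g \<in> monspan E" by (fastforce simp: monspan_def)
    qed
    moreover have "finite B" using fin by (simp add: B_def)
    ultimately show "finite_colength (monspan E)"
      using assms by (auto simp: finite_colength_iff_approx ideal_monspan)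
  }
qed

lemma finite_Compl_wedge:
  assumes "h \<ge> 1" "k \<ge> 1"
  shows "finite (- wedge h k i)"
proof (rule finite_subset)
  show "- wedge h k i \<subseteq> {..i * (h * k)} \<times> {..i * (h * k)}"
  proof clarify
    fix a b assume "(a, b) \<notin> wedge h k i"
    then have "k * a + h * b < i * (h * k)" by (simp add: wedge_def)
    moreover have "a \<le> k * a" "b \<le> h * b" using assms by auto
    ultimately have "a \<le> i * (h * k)" "b \<le> i * (h * k)" by linarith+
    then show "a \<in> {..i * (h * k)} \<and> b \<in> {..i * (h * k)}" by simp
  qed
qed auto

section \<open>Convexity of the exponents of a normal ideal\<close>

text \<open>
  Closure under rational convex combinations of two points, with denominators cleared and up-closure
  built in: every lattice point that dominates \<open>(s p + t q) / (s + t)\<close> belongs to \<open>E\<close>.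
\<close>

definition int_convex :: "(nat \<times> nat) set \<Rightarrow> bool"
  where "int_convex E \<longleftrightarrow> (\<forall>p\<in>E. \<forall>q\<in>E. \<forall>s t a b. 1 \<le> s + t \<longrightarrow>
    s * fst p + t * fst q \<le> (s + t) * a \<longrightarrow> s * snd p + t * snd q \<le> (s + t) * b \<longrightarrow> (a, b) \<in> E)"

lemma int_convexD:
  assumes "int_convex E" "(a1, b1) \<in> E" "(a2, b2) \<in> E" "1 \<le> s + t"
    "s * a1 + t * a2 \<le> (s + t) * a" "s * b1 + t * b2 \<le> (s + t) * b"
  shows "(a, b) \<in> E"
  using assms unfolding int_convex_def by fastforce

lemma to_fract_power:
  "to_fract (f ^ n) = to_fract f ^ n" for f :: "'a::idom"
  by (induction n) simp_all

text \<open>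
  If \<open>m\<^sup>p \<in> I\<^sup>p\<close> for a monomial \<open>m\<close>, then \<open>m t\<close> is a root of \<open>Z\<^sup>p - m\<^sup>p t\<^sup>p\<close>, whose coefficients
  lie in the Rees algebra; normality puts \<open>m t\<close> into the Rees algebra, that is, \<open>m\<close> into \<open>I\<close>.
\<close>

lemma exponents_integrally_closed:
  assumes I: "ideal I cxy" and nd: "normal_domain (rees_algebra I)"
    and d: "xymonom c d \<in> I"
    and p: "p \<ge> 1" "xymonom a b ^ p \<in> ideal_pow I p"
  shows "xymonom a b \<in> I"
proof -
  let ?A = "rees_algebra I"
  have mem: "Polynomial.monom f i \<in> ?A \<longleftrightarrow> f \<in> ideal_pow I i" for f i
    using ideal_ideal_pow[OF I] by (auto simp: rees_algebra_def ideal_cxy_iff)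
  have 1: "ideal_pow I 1 = I" using I by (rule ideal_pow_1)
  \<comment> \<open>The monomial of \<open>I\<close> serves as a common denominator: it puts \<open>w\<close> into the fraction field.\<close>
  define u where "u = Polynomial.monom (xymonom a b * xymonom c d) 1"
  define v where "v = Polynomial.monom (xymonom c d) 0"
  define w where "w = Polynomial.monom (xymonom a b) 1"
  have "u \<in> ?A" using I d unfolding u_def mem 1 by (auto simp: ideal_cxy_iff)
  moreover have "v \<in> ?A" by (simp add: v_def mem)
  moreover have "v \<noteq> 0" by (simp add: v_def xymonom_def)
  moreover have uvw: "u = w * v" by (simp add: u_def v_def w_def mult_monom)
  moreover have "to_fract w = to_fract u / to_fract v"
    using \<open>v \<noteq> 0\<close> by (simp add: uvw)
  ultimately have "to_fract w \<in> fractions ?A"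
    unfolding fractions_def by blast
  moreover have "integral_over (to_fract ` ?A) (to_fract w)"
    unfolding integral_over_def
  proof (intro exI conjI)
    let ?P = "Polynomial.monom 1 p - [:to_fract (w ^ p):]"
    have deg: "Polynomial.degree ?P = p"
      using p by (simp add: diff_conv_add_uminus degree_add_eq_left degree_monom_eq del: add_uminus_conv_diff)
    show "lead_coeff ?P = 1" unfolding deg using p by (simp add: coeff_pCons split: nat.splits)
    have A: "0 \<in> ?A" "1 \<in> ?A" "- (w ^ p) \<in> ?A"
    proof -
      show "0 \<in> ?A" "1 \<in> ?A" using mem[of 0 0] mem[of 1 0] by (auto simp: monom_0 one_pCons)
      have "w ^ p = Polynomial.monom (xymonom a b ^ p) p" by (simp add: w_def monom_power)
      then have "- (w ^ p) = Polynomial.monom (- 1 * xymonom a b ^ p) p" by (simp add: minus_monom)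
      moreover have "- 1 * xymonom a b ^ p \<in> ideal_pow I p"
        using p ideal_ideal_pow[OF I, of p] unfolding ideal_cxy_iff by blast
      ultimately show "- (w ^ p) \<in> ?A" using mem by metis
    qed
    have "Polynomial.coeff ?P i \<in> to_fract ` ?A" for i
    proof -
      have "Polynomial.coeff ?P i = to_fract (if i = p then 1 else if i = 0 then - (w ^ p) else 0)"
        using p by (auto simp: coeff_pCons split: nat.splits)
      then show ?thesis using A by auto
    qed
    then show "set (coeffs ?P) \<subseteq> to_fract ` ?A"
      by (auto simp: coeffs_def simp del: coeff_diff)
    show "poly ?P (to_fract w) = 0"
      by (simp add: poly_monom to_fract_power)
  qed
  ultimately have "to_fract w \<in> to_fract ` ?A"
    using nd by (auto simp: normal_domain_def)
  then have "w \<in> ?A" by auto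
  then show ?thesis using mem 1 by (simp add: w_def)
qed

text \<open>
  If \<open>r\<close> dominates \<open>(s p + t q) / (s + t)\<close>, then \<open>x\<^sup>r\<close> to the power \<open>s + t\<close> is a multiple of
  a product of \<open>s\<close> copies of \<open>x\<^sup>p\<close> and \<open>t\<close> copies of \<open>x\<^sup>q\<close>, so integral closedness applies.
\<close>

lemma int_convex_exponents:
  assumes I: "ideal I cxy" and nd: "normal_domain (rees_algebra I)"
  shows "int_convex (exponents I)"
  unfolding int_convex_def
proof (intro ballI allI impI)
  fix p q s t a b
  assume p: "p \<in> exponents I" and q: "q \<in> exponents I" and st: "1 \<le> s + t"
    and ab: "s * fst p + t * fst q \<le> (s + t) * a" "s * snd p + t * snd q \<le> (s + t) * b"
  obtain a1 b1 a2 b2 where eq: "p = (a1, b1)" "q = (a2, b2)" by (metis surj_pair)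
  have m: "xymonom a1 b1 \<in> I" "xymonom a2 b2 \<in> I" using p q eq by (auto simp: exponents_def)
  have "xymonom a1 b1 ^ s * xymonom a2 b2 ^ t \<in> ideal_pow I (s + t)"
    by (intro ideal_pow_mult_mem power_mem_ideal_pow I m)
  then have "(s * a1 + t * a2, s * b1 + t * b2) \<in> exponents (ideal_pow I (s + t))"
    by (simp add: exponents_def xymonom_power xymonom_mult)
  then have "((s + t) * a, (s + t) * b) \<in> exponents (ideal_pow I (s + t))"
    using ab eq by (auto intro: up_closedD[OF up_closed_exponents[OF ideal_ideal_pow[OF I]]])
  then have "xymonom a b ^ (s + t) \<in> ideal_pow I (s + t)"
    by (simp add: exponents_def xymonom_power)
  then show "(a, b) \<in> exponents I"
    using exponents_integrally_closed[OF I nd m(1) st] by (simp add: exponents_def)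
qed

section \<open>Valuation filtrations and integral closedness\<close>

text \<open>
  The sets \<open>fil c = {x. v x \<ge> c}\<close> of a valuation \<open>v\<close>, with \<open>strict\<close> expressing that
  \<open>v (x y) = v x + v y\<close>. Working with the filtration avoids a value for \<open>v 0\<close>.
\<close>

locale strict_filtration =
  fixes fil :: "int \<Rightarrow> 'a::idom set"
  assumes zero_mem: "0 \<in> fil c"
    and add_mem: "x \<in> fil c \<Longrightarrow> y \<in> fil c \<Longrightarrow> x + y \<in> fil c"
    and uminus_mem: "x \<in> fil c \<Longrightarrow> - x \<in> fil c"
    and mult_mem: "x \<in> fil c \<Longrightarrow> y \<in> fil d \<Longrightarrow> x * y \<in> fil (c + d)"
    and one_mem: "1 \<in> fil 0" and one_notin: "1 \<notin> fil 1"
    and antimono: "c \<le> d \<Longrightarrow> fil d \<subseteq> fil c"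
    and exhaustive: "\<exists>c. x \<in> fil c"
    and strict: "x \<in> fil c \<Longrightarrow> x \<notin> fil (c + 1) \<Longrightarrow> y \<in> fil d \<Longrightarrow> y \<notin> fil (d + 1) \<Longrightarrow>
      x * y \<notin> fil (c + d + 1)"
begin

lemma sum_mem: "(\<And>i. i \<in> A \<Longrightarrow> f i \<in> fil c) \<Longrightarrow> sum f A \<in> fil c"
  by (induction A rule: infinite_finite_induct) (auto simp: zero_mem add_mem)

lemma mem_antimono: "x \<in> fil d \<Longrightarrow> c \<le> d \<Longrightarrow> x \<in> fil c"
  using antimono by blast

lemma power_mem: "x \<in> fil c \<Longrightarrow> x ^ n \<in> fil (int n * c)"
proof (induction n)
  case (Suc n)
  then show ?case using mult_mem[of x c "x ^ n" "int n * c"] by (simp add: algebra_simps)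
qed (simp add: one_mem)

lemma power_strict: "x \<in> fil c \<Longrightarrow> x \<notin> fil (c + 1) \<Longrightarrow> x ^ n \<notin> fil (int n * c + 1)"
proof (induction n)
  case (Suc n)
  then show ?case using strict[of x c "x ^ n" "int n * c"] power_mem[of x c n]
    by (simp add: algebra_simps)
qed (simp add: one_notin)

text \<open>
  If \<open>x\<close> had valuation \<open>- k < 0\<close>, then \<open>x\<^sup>n\<close> would have valuation exactly \<open>- n k\<close>, whereas every
  other term of the integral equation has valuation at least \<open>- (n - 1) k\<close>.
\<close>

lemma integral_mem:
  assumes c: "\<And>i. i < n \<Longrightarrow> c i \<in> fil 0" and root: "(\<Sum>i<n. c i * x ^ i) + x ^ n = 0"
  shows "x \<in> fil 0"
proof (rule ccontr)
  assume x: "x \<notin> fil 0"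
  obtain m where m: "x \<in> fil m" using exhaustive by blast
  have "m < 0" using x mem_antimono[OF m, of 0] by linarith
  define M where "M = {k::nat. x \<in> fil (- int k)}"
  define k where "k = (LEAST k. k \<in> M)"
  have "nat (- m) \<in> M" using m \<open>m < 0\<close> by (simp add: M_def)
  then have "k \<in> M" unfolding k_def by (rule LeastI)
  then have k: "x \<in> fil (- int k)" by (simp add: M_def)
  with x have "k > 0" by (cases k) auto
  then have "k - 1 \<notin> M" using not_less_Least[of "k - 1" "\<lambda>k. k \<in> M"] by (simp add: k_def)
  moreover have "- int (k - 1) = - int k + 1" using \<open>k > 0\<close> by (simp add: of_nat_diff)
  ultimately have k': "x \<notin> fil (- int k + 1)" by (simp add: M_def)
  have "c i * x ^ i \<in> fil (int n * (- int k) + 1)" if "i < n" for i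
  proof -
    have "c i * x ^ i \<in> fil (0 + int i * (- int k))"
      using c that by (intro mult_mem power_mem k)
    moreover have "int n * (- int k) + 1 \<le> 0 + int i * (- int k)"
    proof -
      have "int k * 1 \<le> int k * (int n - int i)"
        using that by (intro mult_left_mono) auto
      then show ?thesis using \<open>k > 0\<close> by (simp add: algebra_simps)
    qed
    ultimately show ?thesis by (rule mem_antimono)
  qed
  then have "- (\<Sum>i<n. c i * x ^ i) \<in> fil (int n * (- int k) + 1)"
    by (intro uminus_mem sum_mem) auto
  moreover have "x ^ n = - (\<Sum>i<n. c i * x ^ i)"
    using root by (simp add: add_eq_0_iff)
  ultimately show False using power_strict[OF k k', of n] by simp
qed

end

text \<open>
  The Gauss extension of a valuation to polynomials, where the indeterminate receives weight \<open>w\<close>.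
\<close>

definition gauss_fil :: "int \<Rightarrow> (int \<Rightarrow> 'a::idom set) \<Rightarrow> int \<Rightarrow> 'a poly set"
  where "gauss_fil w fil c = {F. \<forall>i. Polynomial.coeff F i \<in> fil (c - int i * w)}"

text \<open>
  Multiplicativity is Gauss's lemma: if \<open>i\<close> and \<open>j\<close> are the least indices at which \<open>F\<close> and \<open>G\<close>
  attain their valuations, then in the coefficient of \<open>F G\<close> at \<open>i + j\<close> the product of these two
  coefficients is the only term of minimal valuation and cannot be cancelled.
\<close>

lemma strict_filtration_gauss_fil:
  assumes "strict_filtration fil"
  shows "strict_filtration (gauss_fil w fil)"
proof
  interpret strict_filtration fil by fact
  fix c d :: int and F G :: "'a poly"
  show "0 \<in> gauss_fil w fil c" by (simp add: gauss_fil_def zero_mem)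
  show "F + G \<in> gauss_fil w fil c" if "F \<in> gauss_fil w fil c" "G \<in> gauss_fil w fil c"
    using that by (simp add: gauss_fil_def add_mem)
  show "- F \<in> gauss_fil w fil c" if "F \<in> gauss_fil w fil c"
    using that by (simp add: gauss_fil_def uminus_mem)
  show "1 \<in> gauss_fil w fil 0"
    by (auto simp: gauss_fil_def one_pCons coeff_pCons one_mem zero_mem split: nat.splits)
  show "1 \<notin> gauss_fil w fil 1"
    by (auto simp: gauss_fil_def one_pCons coeff_pCons one_notin intro!: exI[of _ 0])
  show "gauss_fil w fil d \<subseteq> gauss_fil w fil c" if "c \<le> d"
    using that unfolding gauss_fil_def by (auto intro: mem_antimono)
  show "\<exists>c. F \<in> gauss_fil w fil c"
  proof -
    have "\<forall>i. \<exists>m. Polynomial.coeff F i \<in> fil m" using exhaustive by blast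
    then obtain m where m: "\<And>i. Polynomial.coeff F i \<in> fil (m i)" by metis
    define c where "c = Min ((\<lambda>i. m i + int i * w) ` {..Polynomial.degree F})"
    have "Polynomial.coeff F i \<in> fil (c - int i * w)" for i
    proof (cases "i \<le> Polynomial.degree F")
      case True
      then have "c \<le> m i + int i * w" unfolding c_def by (intro Min_le) auto
      then show ?thesis by (intro mem_antimono[OF m]) auto
    qed (simp add: coeff_eq_0 zero_mem)
    then show ?thesis by (auto simp: gauss_fil_def)
  qed
  have prod: "Polynomial.coeff F i * Polynomial.coeff G j \<in> fil (c + d - int (i + j) * w)"
    if "F \<in> gauss_fil w fil c" "G \<in> gauss_fil w fil d" for F G c d i j
  proof -
    have "Polynomial.coeff F i * Polynomial.coeff G j \<in> fil ((c - int i * w) + (d - int j * w))"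
      using that by (intro mult_mem) (auto simp: gauss_fil_def)
    then show ?thesis by (simp add: algebra_simps)
  qed
  show "F * G \<in> gauss_fil w fil (c + d)" if "F \<in> gauss_fil w fil c" "G \<in> gauss_fil w fil d"
    unfolding gauss_fil_def
  proof (intro CollectI allI)
    fix n
    have "Polynomial.coeff F i * Polynomial.coeff G (n - i) \<in> fil (c + d - int n * w)" if "i \<le> n" for i
      using prod[OF \<open>F \<in> _\<close> \<open>G \<in> _\<close>, of i "n - i"] that by simp
    then show "Polynomial.coeff (F * G) n \<in> fil (c + d - int n * w)"
      unfolding coeff_mult by (intro sum_mem) auto
  qed
  show "F * G \<notin> gauss_fil w fil (c + d + 1)"
    if F: "F \<in> gauss_fil w fil c" "F \<notin> gauss_fil w fil (c + 1)"
      and G: "G \<in> gauss_fil w fil d" "G \<notin> gauss_fil w fil (d + 1)"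
  proof -
    define PF where "PF i \<longleftrightarrow> Polynomial.coeff F i \<notin> fil (c + 1 - int i * w)" for i
    define PG where "PG i \<longleftrightarrow> Polynomial.coeff G i \<notin> fil (d + 1 - int i * w)" for i
    define i where "i = (LEAST i. PF i)"
    define j where "j = (LEAST j. PG j)"
    have "\<exists>i. PF i" "\<exists>j. PG j" using F G by (auto simp: gauss_fil_def PF_def PG_def)
    then have ij: "PF i" "PG j" unfolding i_def j_def by (auto intro: LeastI)
    have less: "\<not> PF i'" if "i' < i" for i' using that not_less_Least unfolding i_def by blast
    have less': "\<not> PG j'" if "j' < j" for j' using that not_less_Least unfolding j_def by blast
    define e where "e = c + d + 1 - int (i + j) * w"
    have other: "Polynomial.coeff F i' * Polynomial.coeff G (i + j - i') \<in> fil e"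
      if "i' \<le> i + j" "i' \<noteq> i" for i'
    proof (cases "i' < i")
      case True
      have "Polynomial.coeff F i' * Polynomial.coeff G (i + j - i') \<in>
          fil ((c + 1 - int i' * w) + (d - int (i + j - i') * w))"
        using less[OF True] G by (intro mult_mem) (auto simp: gauss_fil_def PF_def)
      moreover have "(c + 1 - int i' * w) + (d - int (i + j - i') * w) = e"
        using that by (simp add: e_def of_nat_diff algebra_simps)
      ultimately show ?thesis by simp
    next
      case False
      with that have lt: "i + j - i' < j" by auto
      have "Polynomial.coeff F i' * Polynomial.coeff G (i + j - i') \<in>
          fil ((c - int i' * w) + (d + 1 - int (i + j - i') * w))"
        using less'[OF lt] F by (intro mult_mem) (auto simp: gauss_fil_def PG_def)
      moreover have "(c - int i' * w) + (d + 1 - int (i + j - i') * w) = e"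
        using that by (simp add: e_def of_nat_diff algebra_simps)
      ultimately show ?thesis by simp
    qed
    define S where "S = (\<Sum>i'\<in>{..i + j} - {i}. Polynomial.coeff F i' * Polynomial.coeff G (i + j - i'))"
    have "S \<in> fil e" unfolding S_def using other by (intro sum_mem) auto
    have "Polynomial.coeff F i * Polynomial.coeff G j \<notin> fil ((c - int i * w) + (d - int j * w) + 1)"
      using F G ij by (intro strict) (auto simp: gauss_fil_def PF_def PG_def algebra_simps)
    then have main: "Polynomial.coeff F i * Polynomial.coeff G j \<notin> fil e"
      by (simp add: e_def algebra_simps)
    have split: "Polynomial.coeff (F * G) (i + j) = Polynomial.coeff F i * Polynomial.coeff G j + S"
      unfolding S_def coeff_mult by (subst sum.remove[of _ i]) auto
    have "Polynomial.coeff (F * G) (i + j) \<notin> fil e"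
    proof
      assume "Polynomial.coeff (F * G) (i + j) \<in> fil e"
      then have "Polynomial.coeff (F * G) (i + j) + - S \<in> fil e"
        using \<open>S \<in> fil e\<close> by (intro add_mem uminus_mem)
      then show False using main split by simp
    qed
    then show ?thesis by (auto simp: gauss_fil_def e_def intro!: exI[of _ "i + j"])
  qed
qed

definition trivial_fil :: "int \<Rightarrow> 'a::idom set"
  where "trivial_fil c = (if c \<le> 0 then UNIV else {0})"

lemma strict_filtration_trivial_fil: "strict_filtration trivial_fil"
proof
  show "\<exists>c. x \<in> (trivial_fil c :: 'a set)" for x
    by (rule exI[of _ 0]) (simp add: trivial_fil_def)
qed (auto simp: trivial_fil_def split: if_splits)

lemma integral_over_to_fractE:
  assumes "integral_over (to_fract ` A) z"
  obtains n c where "\<And>i. i < n \<Longrightarrow> c i \<in> A" "(\<Sum>i<n. to_fract (c i) * z ^ i) + z ^ n = 0"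
proof -
  obtain p where p: "lead_coeff p = 1" "set (coeffs p) \<subseteq> to_fract ` A" "poly p z = 0"
    using assms by (auto simp: integral_over_def)
  define n where "n = Polynomial.degree p"
  have "p \<noteq> 0" using p by auto
  then have "\<exists>a\<in>A. Polynomial.coeff p i = to_fract a" if "i < n" for i
    using that coeff_in_coeffs[of p i] p(2) by (auto simp: n_def)
  then obtain c where c: "\<And>i. i < n \<Longrightarrow> c i \<in> A \<and> Polynomial.coeff p i = to_fract (c i)" by metis
  have "poly p z = (\<Sum>i<n. Polynomial.coeff p i * z ^ i) + z ^ n"
    using p(1) by (simp add: poly_altdef n_def lessThan_Suc_atMost[symmetric])
  also have "(\<Sum>i<n. Polynomial.coeff p i * z ^ i) = (\<Sum>i<n. to_fract (c i) * z ^ i)"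
    using c by (intro sum.cong) auto
  finally show ?thesis using that[of n c] c p(3) by simp
qed

text \<open>
  The rational root theorem: for \<open>z = a' / b'\<close> in lowest terms, multiplying the equation by
  \<open>b'\<^sup>n\<close> shows that \<open>b'\<close> divides \<open>a'\<^sup>n\<close>, so \<open>b'\<close> is a unit.
\<close>

lemma integral_fraction_in_gcd_domain:
  fixes a b :: "'a::{idom, semiring_gcd}"
  assumes "b \<noteq> 0" and root: "(\<Sum>i<n. to_fract (c i) * (to_fract a / to_fract b) ^ i) + (to_fract a / to_fract b) ^ n = 0"
  obtains x where "to_fract a / to_fract b = to_fract x"
proof -
  have "gcd a b \<noteq> 0" using assms by simp
  then obtain a' b' where ab: "a = a' * gcd a b" "b = b' * gcd a b" "coprime a' b'"
    using gcd_coprime_exists by blast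
  have b': "b' \<noteq> 0" using ab \<open>b \<noteq> 0\<close> by auto
  define z where "z = to_fract a / to_fract b"
  have "to_fract a = to_fract a' * to_fract (gcd a b)" "to_fract b = to_fract b' * to_fract (gcd a b)"
    using ab to_fract_mult by metis+
  then have z: "z = to_fract a' / to_fract b'"
    using \<open>gcd a b \<noteq> 0\<close> by (simp add: z_def del: to_fract_mult)
  have "z ^ i * to_fract (b' ^ n) = to_fract (a' ^ i * b' ^ (n - i))" if "i \<le> n" for i
  proof -
    have "b' ^ n = b' ^ i * b' ^ (n - i)" using that by (simp flip: power_add)
    then show ?thesis using b' by (simp add: z to_fract_power power_divide)
  qed
  note pow = this
  have "0 = ((\<Sum>i<n. to_fract (c i) * z ^ i) + z ^ n) * to_fract (b' ^ n)"
    using root by (simp add: z_def)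
  also have "\<dots> = (\<Sum>i<n. to_fract (c i) * (z ^ i * to_fract (b' ^ n))) + z ^ n * to_fract (b' ^ n)"
    by (simp add: sum_distrib_right distrib_right mult.assoc del: to_fract_mult)
  also have "\<dots> = (\<Sum>i<n. to_fract (c i) * to_fract (a' ^ i * b' ^ (n - i))) + to_fract (a' ^ n * b' ^ (n - n))"
    using pow by (intro arg_cong2[of _ _ _ _ "(+)"] sum.cong) auto
  also have "\<dots> = to_fract ((\<Sum>i<n. c i * (a' ^ i * b' ^ (n - i))) + a' ^ n)"
    by (simp add: to_fract_sum)
  finally have "a' ^ n = - (\<Sum>i<n. c i * (a' ^ i * b' ^ (n - i)))"
    by (metis add.commute add_eq_0_iff to_fract_eq_0_iff)
  moreover have "b' dvd (\<Sum>i<n. c i * (a' ^ i * b' ^ (n - i)))"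
    by (intro dvd_sum dvd_mult dvd_power) auto
  ultimately have "b' dvd a' ^ n" by simp
  moreover have "coprime (a' ^ n) b'" using ab(3) by simp
  ultimately have "b' dvd 1" by (metis coprime_common_divisor dvd_refl)
  then obtain u where "1 = b' * u" by (elim dvdE)
  then have "to_fract b' * to_fract u = 1" by (metis to_fract_1 to_fract_mult)
  then have "z = to_fract (a' * u)" using b' by (simp add: z divide_eq_eq mult.assoc mult.commute[of "to_fract u"])
  then show ?thesis using that[of "a' * u"] by (simp only: z_def)
qed

lemma subdomain_of_idom:
  fixes A :: "'a::idom set"
  assumes "1 \<in> A" "\<And>x. x \<in> A \<Longrightarrow> - x \<in> A" "\<And>x y. x \<in> A \<Longrightarrow> y \<in> A \<Longrightarrow> x * y \<in> A"
    "\<And>x y. x \<in> A \<Longrightarrow> y \<in> A \<Longrightarrow> x + y \<in> A"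
  shows "subdomain A ring_of_type_algebra"
proof -
  interpret cring "ring_of_type_algebra :: 'a ring" by (rule cring_from_type_algebra)
  interpret domain "ring_of_type_algebra :: 'a ring"
    by (intro domain.intro domain_axioms.intro cring_from_type_algebra) simp_all
  have "\<ominus>\<^bsub>ring_of_type_algebra\<^esub> x = - x" for x :: 'a
    by (intro minus_equality) auto
  then show ?thesis
    using assms by (intro subdomainI' subringI) auto
qed

lemma normal_domain_fil:
  fixes fil :: "int \<Rightarrow> 'a::{idom, semiring_gcd} set"
  assumes "strict_filtration fil"
  shows "normal_domain (fil 0)"
  unfolding normal_domain_def
proof (intro conjI ballI impI)
  interpret strict_filtration fil by fact
  show "subdomain (fil 0) ring_of_type_algebra"
    using mult_mem[of _ 0 _ 0] by (intro subdomain_of_idom one_mem uminus_mem add_mem) auto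
  fix z assume z: "z \<in> fractions (fil 0)" "integral_over (to_fract ` fil 0) z"
  obtain n c where nc: "\<And>i. i < n \<Longrightarrow> c i \<in> fil 0" "(\<Sum>i<n. to_fract (c i) * z ^ i) + z ^ n = 0"
    using integral_over_to_fractE[OF z(2)] by blast
  obtain a b where "b \<noteq> 0" and ab: "z = to_fract a / to_fract b"
    using z(1) unfolding fractions_def by blast
  then obtain x where x: "z = to_fract x"
    using integral_fraction_in_gcd_domain[OF _ nc(2)[unfolded ab]] unfolding ab by blast
  have "to_fract ((\<Sum>i<n. c i * x ^ i) + x ^ n) = 0"
    using nc(2) by (simp add: x to_fract_power to_fract_sum)
  then have "(\<Sum>i<n. c i * x ^ i) + x ^ n = 0"
    by (simp only: to_fract_eq_0_iff)
  with nc(1) have "x \<in> fil 0" by (rule integral_mem)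
  then show "z \<in> to_fract ` fil 0" using x by auto
qed

section \<open>The ideals n(h,k) are normal\<close>

text \<open>
  A monomial \<open>x\<^sup>a y\<^sup>b t\<^sup>i\<close> belongs to the Rees algebra iff \<open>k a + h b - i h k \<ge> 0\<close>.
\<close>

lemma rees_algebra_nn:
  assumes "h \<ge> 1" "k \<ge> 1"
  shows "rees_algebra (\<nn> h k) =
    gauss_fil (- int (h * k)) (gauss_fil (int h) (gauss_fil (int k) trivial_fil)) 0"
proof -
  have le: "(int i * int (h * k) - int b * int h - int a * int k \<le> 0) \<longleftrightarrow> (a, b) \<in> wedge h k i" for i a b
  proof -
    have "(a, b) \<in> wedge h k i \<longleftrightarrow> int (i * (h * k)) \<le> int (k * a + h * b)"
      unfolding wedge_def of_nat_le_iff by simp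
    then show ?thesis by (auto simp: algebra_simps)
  qed
  have "rees_algebra (\<nn> h k) = {F. \<forall>i. Polynomial.coeff F i \<in> monspan (wedge h k i)}"
    by (simp add: rees_algebra_def nn_eq_monspan[OF assms] ideal_pow_wedge[unfolded One_nat_def])
  also have "\<dots> = gauss_fil (- int (h * k)) (gauss_fil (int h) (gauss_fil (int k) trivial_fil)) 0"
  proof -
    have "(x \<noteq> 0 \<longrightarrow> (a, b) \<in> wedge h k i) \<longleftrightarrow>
        x \<in> trivial_fil (0 - int i * - int (h * k) - int b * int h - int a * int k)" for x :: complex and i a b
      unfolding le[symmetric] by (auto simp: trivial_fil_def)
    then show ?thesis unfolding monspan_def gauss_fil_def by blast
  qed
  finally show ?thesis .
qed

lemma nn_in_NN:
  assumes "h \<ge> 1" "k \<ge> 1"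
  shows "\<nn> h k \<in> \<NN>"
proof -
  have "normal_domain (rees_algebra (\<nn> h k))"
    unfolding rees_algebra_nn[OF assms]
    by (intro normal_domain_fil strict_filtration_gauss_fil strict_filtration_trivial_fil)
  then show ?thesis
    using assms unfolding normal_monomial_ideals_def
    by (auto simp: nn_eq_monspan finite_colength_monspan_iff up_closed_wedge finite_Compl_wedge
        intro: monomial_ideal_monspan)
qed

section \<open>Existence of the factorisation\<close>

text \<open>
  With \<open>(0, n)\<close> the lowest point of \<open>E\<close> on the \<open>y\<close>-axis, let \<open>b / a\<close> in lowest terms be the
  largest slope \<open>(n - v) / u\<close> towards a point \<open>(u, v)\<close> of \<open>E\<close> below height \<open>n\<close>. Then \<open>E\<close> lies
  above the line through \<open>(0, n)\<close> with direction \<open>(a, - b)\<close>, and by convexity \<open>(a, n - b) \<in> E\<close>.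

  A point of \<open>E\<close> with \<open>u \<ge> a\<close> splits as \<open>(a, 0)\<close> plus a point of the shifted set; one with
  \<open>u < a\<close> lies above the line, so it splits as a point of the wedge plus \<open>(0, n - b)\<close>. Conversely,
  if \<open>q + (a, 0) \<in> E\<close> then also \<open>q + (0, b) \<in> E\<close>: moving from \<open>q + (a, 0)\<close> parallel to the steepest
  edge never leaves \<open>E\<close> before the \<open>y\<close>-axis. All other points of the wedge dominate a convex
  combination of these two translates.
\<close>

lemma split_first_edge:
  assumes up: "up_closed E" and conv: "int_convex E"
    and m: "(m, 0) \<in> E" and n: "(0, n) \<in> E" and least: "\<And>j. j < n \<Longrightarrow> (0, j) \<notin> E" and "n > 0"
  obtains a b where "a \<ge> 1" "b \<ge> 1" "b \<le> n" "coprime a b" "(a, n - b) \<in> E"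
    "E = wedge a b 1 + {(u, v). (u + a, v) \<in> E}"
proof -
  have "m > 0" using m least[OF \<open>n > 0\<close>] by (cases m) auto
  \<comment> \<open>Points to the right of \<open>(m, 0)\<close> have smaller slope than \<open>(m, 0)\<close>, so a finite set of candidates suffices.\<close>
  define C where "C = E \<inter> ({1..m} \<times> {..<n})"
  define slope where "slope = (\<lambda>(u, v). real (n - v) / real u)"
  have C: "finite C" "(m, 0) \<in> C" using m \<open>m > 0\<close> \<open>n > 0\<close> by (auto simp: C_def)
  then have "Max (slope ` C) \<in> slope ` C" by (intro Max_in) auto
  then obtain u0 v0 where uv0: "(u0, v0) \<in> C" "slope (u0, v0) = Max (slope ` C)" by auto
  have max: "(n - v) * u0 \<le> (n - v0) * u" if "(u, v) \<in> C" for u v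
  proof -
    have "slope (u, v) \<le> slope (u0, v0)"
      unfolding uv0(2) using C that by (intro Max_ge) auto
    moreover have "u > 0" "u0 > 0" using that uv0 by (auto simp: C_def)
    ultimately have "real ((n - v) * u0) \<le> real ((n - v0) * u)"
      by (simp add: slope_def field_simps)
    then show ?thesis by (simp only: of_nat_le_iff)
  qed
  define d where "d = gcd u0 (n - v0)"
  have uv: "u0 > 0" "v0 < n" "(u0, v0) \<in> E" using uv0 by (auto simp: C_def)
  have "d \<noteq> 0" using uv by (simp add: d_def)
  then obtain a b where ab: "u0 = a * d" "n - v0 = b * d" "coprime a b"
    using gcd_coprime_exists[of u0 "n - v0"] unfolding d_def by blast
  have "a \<ge> 1" "b \<ge> 1" using ab uv by (auto simp: Suc_le_eq intro!: Nat.gr0I)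
  have "b * 1 \<le> b * d" using \<open>d \<noteq> 0\<close> by (intro mult_le_mono2) auto
  then have "b \<le> n" using ab by linarith
  have max': "(n - v) * a \<le> b * u" if "(u, v) \<in> C" for u v
  proof -
    have "((n - v) * a) * d \<le> (b * u) * d" using max[OF that] ab by (simp add: mult_ac)
    then show ?thesis using \<open>d \<noteq> 0\<close> by simp
  qed
  have support: "a * n \<le> b * u + a * v" if "(u, v) \<in> E" for u v
  proof -
    have "u \<noteq> 0" if "v < n" using least[OF that] \<open>(u, v) \<in> E\<close> by (intro notI) simp
    then consider "v \<ge> n" | "v < n" "1 \<le> u" "u \<le> m" | "u > m" by linarith
    then show ?thesis
    proof cases
      case 1
      then show ?thesis by (simp add: trans_le_add2)
    next
      case 2
      then have "(n - v) * a \<le> b * u" using that by (intro max') (auto simp: C_def)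
      moreover have "(n - v) * a + v * a = n * a" using 2 by (simp flip: add_mult_distrib)
      ultimately show ?thesis by (simp add: mult.commute)
    next
      case 3
      have "n * a \<le> b * m" using max'[OF C(2)] by simp
      also have "\<dots> \<le> b * u" using 3 by simp
      finally show ?thesis by (simp add: mult.commute trans_le_add1)
    qed
  qed
  have corner: "(a, n - b) \<in> E"
  proof (rule int_convexD[OF conv n uv(3)])
    show "1 \<le> (d - 1) + 1" by simp
    show "(d - 1) * 0 + 1 * u0 \<le> ((d - 1) + 1) * a" using ab \<open>d \<noteq> 0\<close> by simp
    obtain e where e: "d = Suc e" using \<open>d \<noteq> 0\<close> by (cases d) auto
    then have "n = b + (b * e + v0)" using ab(2) uv(2) by (simp add: algebra_simps)
    then show "(d - 1) * n + 1 * v0 \<le> ((d - 1) + 1) * (n - b)"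
      by (simp add: e algebra_simps)
  qed
  have "E = wedge a b 1 + {(u, v). (u + a, v) \<in> E}"
  proof
    show "E \<subseteq> wedge a b 1 + {(u, v). (u + a, v) \<in> E}"
    proof clarify
      fix u v assume e: "(u, v) \<in> E"
      show "(u, v) \<in> wedge a b 1 + {(u, v). (u + a, v) \<in> E}"
      proof (cases "u \<ge> a")
        case True
        then have "(a, 0) + (u - a, v) \<in> wedge a b 1 + {(u, v). (u + a, v) \<in> E}"
          using e by (intro set_plus_intro) (auto simp: wedge_def)
        then show ?thesis using True by simp
      next
        case False
        have sup: "a * n \<le> b * u + a * v" using support e by blast
        have "b * u \<le> b * a" using False by simp
        with sup have "a * n \<le> b * a + a * v" by linarith
        then have "a * n \<le> a * (b + v)" by (simp add: algebra_simps)
        then have v: "n - b \<le> v" using \<open>a \<ge> 1\<close> by simp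
        have "a * b \<le> b * u + a * (v - (n - b))"
        proof -
          have "a * (v - (n - b)) + a * n = a * v + a * b"
            using v \<open>b \<le> n\<close> by (simp flip: add_mult_distrib2)
          then show ?thesis using sup by linarith
        qed
        then have "(u, v - (n - b)) + (0, n - b) \<in> wedge a b 1 + {(u, v). (u + a, v) \<in> E}"
          using corner by (intro set_plus_intro) (auto simp: wedge_def)
        then show ?thesis using v by simp
      qed
    qed
    show "wedge a b 1 + {(u, v). (u + a, v) \<in> E} \<subseteq> E"
    proof clarify
      fix r1 r2 assume "(r1, r2) \<in> wedge a b 1 + {(u, v). (u + a, v) \<in> E}"
      then obtain p1 p2 q1 q2 where r: "r1 = p1 + q1" "r2 = p2 + q2"
        and p: "a * b \<le> b * p1 + a * p2" and q: "(q1 + a, q2) \<in> E"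
        by (auto simp: set_plus_def wedge_def)
      \<comment> \<open>\<open>(q1, q2 + b)\<close> dominates the point with abscissa \<open>q1\<close> on the segment from \<open>(0, n)\<close> to \<open>(q1 + a, q2)\<close>.\<close>
      have q': "(q1, q2 + b) \<in> E"
      proof (rule int_convexD[OF conv q n])
        show "1 \<le> q1 + a" using \<open>a \<ge> 1\<close> by simp
        show "q1 * (q1 + a) + a * 0 \<le> (q1 + a) * q1" by (simp add: algebra_simps)
        show "q1 * q2 + a * n \<le> (q1 + a) * (q2 + b)"
          using support[OF q] by (simp add: algebra_simps)
      qed
      show "(r1, r2) \<in> E"
      proof (cases "p1 \<ge> a")
        case True
        then show ?thesis using up_closedD[OF up q] r by simp
      next
        case False
        then obtain e where e: "a = p1 + e" by (metis le_add_diff_inverse nat_le_linear)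
        show ?thesis
        proof (rule int_convexD[OF conv q q'])
          show "1 \<le> p1 + e" using e \<open>a \<ge> 1\<close> by simp
          show "p1 * (q1 + a) + e * q1 \<le> (p1 + e) * r1" using e r by (simp add: algebra_simps)
          have "e * b \<le> a * p2" using p e by (simp add: algebra_simps)
          then show "p1 * q2 + e * (q2 + b) \<le> (p1 + e) * r2"
            using e r by (simp add: algebra_simps)
        qed
      qed
    qed
  qed
  then show ?thesis using that \<open>a \<ge> 1\<close> \<open>b \<ge> 1\<close> \<open>b \<le> n\<close> ab(3) corner by blast
qed

lemma nn_pow_eq:
  assumes "h \<ge> 1" "k \<ge> 1"
  shows "ideal_pow (\<nn> h k) i = monspan (wedge h k i)"
  using assms ideal_pow_wedge by (simp add: nn_eq_monspan)

lemma exists_factorisation: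
  assumes "up_closed E" "int_convex E" "(m, 0) \<in> E" "(0, n) \<in> E"
  shows "\<exists>P \<delta>. finite P \<and> (\<forall>(a, b)\<in>P. a \<ge> 1 \<and> b \<ge> 1 \<and> coprime a b \<and> \<delta> (a, b) \<ge> (1::nat)) \<and>
    monspan E = (\<Otimes>\<^bsub>ideals_set cxy\<^esub> p\<in>P. ideal_pow (\<nn> (fst p) (snd p)) (\<delta> p))"
  using assms
proof (induction n arbitrary: E m rule: less_induct)
  case (less n)
  define n0 where "n0 = (LEAST j. (0, j) \<in> E)"
  have n0: "(0, n0) \<in> E" "n0 \<le> n" and least: "\<And>j. j < n0 \<Longrightarrow> (0, j) \<notin> E"
    unfolding n0_def using less.prems(4) by (auto intro: LeastI Least_le dest: not_less_Least)
  show ?case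
  proof (cases "n0 = 0")
    case True
    then have "E = UNIV" using n0 up_closedD[OF less.prems(1), of 0 0] by auto
    then show ?thesis by (intro exI[of _ "{}"]) (simp add: monspan_UNIV)
  next
    case False
    obtain a b where ab: "a \<ge> 1" "b \<ge> 1" "b \<le> n0" "coprime a b" "(a, n0 - b) \<in> E"
      and E: "E = wedge a b 1 + {(u, v). (u + a, v) \<in> E}"
      using split_first_edge[OF less.prems(1-3) n0(1) least] False by blast
    define E' where "E' = {(u, v). (u + a, v) \<in> E}"
    have up: "up_closed E'"
      using less.prems(1) unfolding up_closed_def E'_def by auto
    have conv: "int_convex E'"
      unfolding int_convex_def
    proof (intro ballI allI impI)
      fix p q s t x y
      assume *: "p \<in> E'" "q \<in> E'" "1 \<le> s + t" "s * fst p + t * fst q \<le> (s + t) * x"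
        "s * snd p + t * snd q \<le> (s + t) * y"
      then have "(fst p + a, snd p) \<in> E" "(fst q + a, snd q) \<in> E" by (auto simp: E'_def)
      then have "(x + a, y) \<in> E"
        by (rule int_convexD[OF less.prems(2)]) (use * in \<open>auto simp: algebra_simps\<close>)
      then show "(x, y) \<in> E'" by (simp add: E'_def)
    qed
    have "(m, 0) \<in> E'" using up_closedD[OF less.prems(1,3)] by (simp add: E'_def)
    moreover have "(0, n0 - b) \<in> E'" using ab by (simp add: E'_def)
    moreover have "n0 - b < n" using ab n0 by linarith
    ultimately obtain P \<delta> where P: "finite P"
      "\<forall>(a, b)\<in>P. a \<ge> 1 \<and> b \<ge> 1 \<and> coprime a b \<and> \<delta> (a, b) \<ge> (1::nat)"
      and E': "monspan E' = (\<Otimes>\<^bsub>ideals_set cxy\<^esub> p\<in>P. ideal_pow (\<nn> (fst p) (snd p)) (\<delta> p))"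
      using less.IH[of "n0 - b" E' m] up conv by blast
    define F where "F = (\<lambda>\<delta> p. ideal_pow (\<nn> (fst p) (snd p)) (\<delta> p))"
    define Q where "Q = P - {(a, b)}"
    \<comment> \<open>The direction \<open>(a, b)\<close> may occur in \<open>P\<close> already; then its multiplicity increases by one.\<close>
    define d where "d = (if (a, b) \<in> P then \<delta> (a, b) else 0)"
    define \<delta>' where "\<delta>' = \<delta>((a, b) := Suc d)"
    have F: "ideal (F \<epsilon> p) cxy" if "p \<in> insert (a, b) P" for p \<epsilon>
    proof -
      have "fst p \<ge> 1 \<and> snd p \<ge> 1" using that P(2) ab by (cases p) auto
      then show ?thesis by (simp add: F_def ideal_ideal_pow ideal_nn)
    qed
    have nn: "ideal (\<nn> a b) cxy" using ab by (simp add: ideal_nn)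
    have Q: "finite Q" "(a, b) \<notin> Q" "Q \<subseteq> P" using P by (auto simp: Q_def)
    have carr: "F \<epsilon> \<in> Q \<rightarrow> carrier (ideals_set cxy)" for \<epsilon>
      using F Q by (auto simp del: type_ring_simps)
    define R where "R = finprod (ideals_set cxy) (F \<delta>) Q"
    have R: "ideal R cxy"
      using ideals.finprod_closed[OF carr[of \<delta>]] by (simp add: R_def)
    have split_P: "monspan E' = ideal_prod cxy (ideal_pow (\<nn> a b) d) R"
    proof (cases "(a, b) \<in> P")
      case True
      then have "P = insert (a, b) Q" by (auto simp: Q_def)
      then have "monspan E' = finprod (ideals_set cxy) (F \<delta>) (insert (a, b) Q)"
        by (simp add: E' F_def)
      also have "\<dots> = ideal_prod cxy (F \<delta> (a, b)) R"
        unfolding R_def using Q carr F by (subst ideals.finprod_insert) auto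
      finally show ?thesis using True by (simp add: F_def d_def)
    next
      case False
      then have "Q = P" by (simp add: Q_def)
      then have "monspan E' = R" by (simp add: E' F_def R_def)
      then show ?thesis
        using False ideals.l_one[of R] R by (simp add: d_def del: type_ring_simps)
    qed
    have "monspan E = ideal_prod cxy (\<nn> a b) (monspan E')"
      using ideal_prod_monspan[OF up_closed_wedge up, of a b 1] E ab
      by (simp add: nn_eq_monspan E'_def)
    also have "\<dots> = ideal_prod cxy (ideal_prod cxy (\<nn> a b) (ideal_pow (\<nn> a b) d)) R"
      unfolding split_P using ideals.m_assoc[of "\<nn> a b" "ideal_pow (\<nn> a b) d" R] nn R
      by (simp add: ideal_ideal_pow)
    also have "ideal_prod cxy (\<nn> a b) (ideal_pow (\<nn> a b) d) = F \<delta>' (a, b)"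
      using ideals.nat_pow_Suc2[of "\<nn> a b" d] nn by (simp add: F_def \<delta>'_def)
    also have "R = finprod (ideals_set cxy) (F \<delta>') Q"
      unfolding R_def using carr Q by (intro ideals.finprod_cong') (auto simp: F_def \<delta>'_def)
    also have "ideal_prod cxy (F \<delta>' (a, b)) (finprod (ideals_set cxy) (F \<delta>') Q) =
        finprod (ideals_set cxy) (F \<delta>') (insert (a, b) Q)"
      using Q carr F by (subst ideals.finprod_insert) auto
    also have "insert (a, b) Q = insert (a, b) P" by (auto simp: Q_def)
    finally have "monspan E = finprod (ideals_set cxy) (F \<delta>') (insert (a, b) P)" .
    moreover have "\<forall>(x, y)\<in>insert (a, b) P. x \<ge> 1 \<and> y \<ge> 1 \<and> coprime x y \<and> \<delta>' (x, y) \<ge> 1"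
      using P(2) ab by (auto simp: \<delta>'_def)
    ultimately show ?thesis using P(1) unfolding F_def by blast
  qed
qed

lemma exists_is_factorisation:
  assumes "I \<in> \<NN>"
  shows "\<exists>t \<alpha> \<beta> \<delta>. is_factorisation I t \<alpha> \<beta> \<delta>"
proof -
  have I: "I = monspan (exponents I)" "ideal I cxy"
    using assms monomial_ideal_eq_monspan by (auto simp: normal_monomial_ideals_def)
  have up: "up_closed (exponents I)" using I by (simp add: up_closed_exponents)
  have conv: "int_convex (exponents I)"
    using assms I by (auto simp: normal_monomial_ideals_def intro: int_convex_exponents)
  have "finite (- exponents I)"
    using assms I finite_colength_monspan_iff[OF up] by (auto simp: normal_monomial_ideals_def)
  then have fin: "finite (fst ` (- exponents I) \<union> snd ` (- exponents I))" by simp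
  \<comment> \<open>A number that is no coordinate of a missing exponent yields points of \<open>exponents I\<close> on both axes.\<close>
  obtain m where m: "m \<notin> fst ` (- exponents I) \<union> snd ` (- exponents I)"
    using ex_new_if_finite[OF infinite_UNIV_nat fin] by blast
  then have axes: "(m, 0) \<in> exponents I" "(0, m) \<in> exponents I" by force+
  obtain P \<delta> where P: "finite P"
      "\<forall>(a, b)\<in>P. a \<ge> 1 \<and> b \<ge> 1 \<and> coprime a b \<and> \<delta> (a, b) \<ge> (1::nat)"
      "I = (\<Otimes>\<^bsub>ideals_set cxy\<^esub> p\<in>P. ideal_pow (\<nn> (fst p) (snd p)) (\<delta> p))"
    using exists_factorisation[OF up conv axes] unfolding I(1)[symmetric]
    by (elim exE conjE) (rule that)
  obtain h where h: "bij_betw h {1..card P} P"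
    using ex_bij_betw_nat_finite_1[OF P(1)] by blast
  have P': "fst p \<ge> 1 \<and> snd p \<ge> 1 \<and> coprime (fst p) (snd p) \<and> \<delta> p \<ge> 1" if "p \<in> P" for p
    using P(2) that by (cases p) auto
  have him: "h ` {1..card P} = P" "inj_on h {1..card P}" using h by (auto simp: bij_betw_def)
  have "(\<lambda>p. ideal_pow (\<nn> (fst p) (snd p)) (\<delta> p)) \<in> h ` {1..card P} \<rightarrow> carrier (ideals_set cxy)"
    using P' him by (auto intro!: ideal_ideal_pow ideal_nn)
  then have "I = (\<Otimes>\<^bsub>ideals_set cxy\<^esub> k\<in>{1..card P}. ideal_pow (\<nn> (fst (h k)) (snd (h k))) (\<delta> (h k)))"
    using P(3) ideals.finprod_reindex[OF _ him(2)] him(1) by simp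
  moreover have "h k \<in> P" if "k \<in> {1..card P}" for k using that him by blast
  ultimately have "is_factorisation I (card P) (\<lambda>k. fst (h k)) (\<lambda>k. snd (h k)) (\<lambda>k. \<delta> (h k))"
    unfolding is_factorisation_def using P' him(2) by (auto simp: coprime_iff_gcd_eq_1)
  then show ?thesis by blast
qed

section \<open>The support function and uniqueness\<close>

definition support :: "(nat \<times> nat) set \<Rightarrow> nat \<Rightarrow> nat \<Rightarrow> nat"
  where "support E u v = Inf ((\<lambda>(a, b). u * a + v * b) ` E)"

lemma support_eqI:
  assumes "(a, b) \<in> E" "u * a + v * b = s" "\<And>c d. (c, d) \<in> E \<Longrightarrow> s \<le> u * c + v * d"
  shows "support E u v = s"
  unfolding support_def using assms by (intro cInf_eq_minimum) force+

lemma support_attained: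
  assumes "E \<noteq> {}"
  obtains a b where "(a, b) \<in> E" "support E u v = u * a + v * b"
proof -
  have "support E u v \<in> (\<lambda>(a, b). u * a + v * b) ` E"
    unfolding support_def using assms by (intro Inf_nat_def1) auto
  then show ?thesis using that by auto
qed

lemma support_le: "(a, b) \<in> E \<Longrightarrow> support E u v \<le> u * a + v * b"
  unfolding support_def by (intro cInf_lower) auto

text \<open>
  A linear functional on a Minkowski sum is minimised in each summand separately.
\<close>

lemma support_plus:
  assumes "E \<noteq> {}" "F \<noteq> {}"
  shows "support (E + F) u v = support E u v + support F u v"
proof -
  obtain a b where ab: "(a, b) \<in> E" "support E u v = u * a + v * b"
    using support_attained[OF assms(1)] .
  obtain c d where cd: "(c, d) \<in> F" "support F u v = u * c + v * d"
    using support_attained[OF assms(2)] .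
  show ?thesis
  proof (rule support_eqI)
    show "(a + c, b + d) \<in> E + F" using set_plus_intro[OF ab(1) cd(1)] by simp
    show "u * (a + c) + v * (b + d) = support E u v + support F u v"
      using ab cd by (simp add: algebra_simps)
  next
    fix x y assume "(x, y) \<in> E + F"
    then obtain x1 y1 x2 y2 where xy: "(x1, y1) \<in> E" "(x2, y2) \<in> F" "x = x1 + x2" "y = y1 + y2"
      by (auto simp: set_plus_def)
    then show "support E u v + support F u v \<le> u * x + v * y"
      using support_le[OF xy(1), of u v] support_le[OF xy(2), of u v] by (simp add: algebra_simps)
  qed
qed

text \<open>
  A linear functional on the wedge is minimised at one of the two corners.
\<close>

lemma support_wedge:
  assumes "h \<ge> 1" "k \<ge> 1"
  shows "support (wedge h k i) u v = i * min (u * h) (v * k)"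
proof (cases "u * h \<le> v * k")
  case True
  show ?thesis
  proof (rule support_eqI)
    show "(i * h, 0) \<in> wedge h k i" by (simp add: wedge_def)
    show "u * (i * h) + v * 0 = i * min (u * h) (v * k)" using True by simp
  next
    fix c d assume "(c, d) \<in> wedge h k i"
    then have "u * (i * (h * k)) \<le> u * (k * c + h * d)" by (simp add: wedge_def)
    also have "\<dots> \<le> k * (u * c) + (v * k) * d"
      using mult_le_mono1[OF True, of d] by (simp add: algebra_simps)
    finally have "k * (i * (u * h)) \<le> k * (u * c + v * d)" by (simp add: algebra_simps)
    then show "i * min (u * h) (v * k) \<le> u * c + v * d" using True assms by simp
  qed
next
  case False
  show ?thesis
  proof (rule support_eqI)
    show "(0, i * k) \<in> wedge h k i" by (simp add: wedge_def)
    show "u * 0 + v * (i * k) = i * min (u * h) (v * k)" using False by simp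
  next
    fix c d assume "(c, d) \<in> wedge h k i"
    then have "v * (i * (h * k)) \<le> v * (k * c + h * d)" by (simp add: wedge_def)
    also have "\<dots> \<le> (u * h) * c + h * (v * d)"
      using mult_le_mono1[of "v * k" "u * h" c] False by (simp add: algebra_simps)
    finally have "h * (i * (v * k)) \<le> h * (u * c + v * d)" by (simp add: algebra_simps)
    then show "i * min (u * h) (v * k) \<le> u * c + v * d" using False assms by simp
  qed
qed

lemma finprod_nn_eq_monspan:
  assumes "finite K" "\<And>k. k \<in> K \<Longrightarrow> \<alpha> k \<ge> 1 \<and> \<beta> k \<ge> 1"
  shows "\<exists>E. up_closed E \<and> E \<noteq> {} \<and>
    (\<Otimes>\<^bsub>ideals_set cxy\<^esub> k\<in>K. ideal_pow (\<nn> (\<alpha> k) (\<beta> k)) (\<delta> k)) = monspan E \<and>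
    (\<forall>u v. support E u v = (\<Sum>k\<in>K. \<delta> k * min (u * \<alpha> k) (v * \<beta> k)))"
  using assms
proof (induction K rule: finite_induct)
  case empty
  have "support UNIV u v = 0" for u v by (rule support_eqI[of 0 0]) auto
  then show ?case by (intro exI[of _ UNIV]) (simp add: up_closed_def monspan_UNIV)
next
  case (insert j K)
  then obtain E where E: "up_closed E" "E \<noteq> {}"
    "(\<Otimes>\<^bsub>ideals_set cxy\<^esub> k\<in>K. ideal_pow (\<nn> (\<alpha> k) (\<beta> k)) (\<delta> k)) = monspan E"
    "\<And>u v. support E u v = (\<Sum>k\<in>K. \<delta> k * min (u * \<alpha> k) (v * \<beta> k))"
    by auto
  define W where "W = wedge (\<alpha> j) (\<beta> j) (\<delta> j)"
  have j: "\<alpha> j \<ge> 1" "\<beta> j \<ge> 1" using insert.prems by auto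
  have ideals: "ideal (ideal_pow (\<nn> (\<alpha> k) (\<beta> k)) (\<delta> k)) cxy" if "k \<in> insert j K" for k
    using insert.prems[OF that] by (simp add: ideal_ideal_pow ideal_nn)
  have W: "up_closed W" "ideal_pow (\<nn> (\<alpha> j) (\<beta> j)) (\<delta> j) = monspan W"
    using j by (simp_all add: W_def up_closed_wedge nn_pow_eq)
  have "(\<delta> j * \<alpha> j, 0) \<in> W" by (simp add: W_def wedge_def)
  then have "W \<noteq> {}" by blast
  have "(\<Otimes>\<^bsub>ideals_set cxy\<^esub> k\<in>insert j K. ideal_pow (\<nn> (\<alpha> k) (\<beta> k)) (\<delta> k)) =
      ideal_prod cxy (monspan W) (monspan E)"
    using insert.hyps ideals by (subst ideals.finprod_insert) (auto simp: E(1,3) W ideal_monspan)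
  also have "\<dots> = monspan (W + E)" using W E by (intro ideal_prod_monspan)
  finally have "(\<Otimes>\<^bsub>ideals_set cxy\<^esub> k\<in>insert j K. ideal_pow (\<nn> (\<alpha> k) (\<beta> k)) (\<delta> k)) = monspan (W + E)" .
  moreover have "support (W + E) u v = (\<Sum>k\<in>insert j K. \<delta> k * min (u * \<alpha> k) (v * \<beta> k))" for u v
    using insert.hyps j E \<open>W \<noteq> {}\<close> by (simp add: support_plus W_def support_wedge)
  moreover have "W + E \<noteq> {}" using \<open>W \<noteq> {}\<close> E(2) by (metis all_not_in_conv set_plus_intro)
  ultimately show ?case using W(1) by (intro exI[of _ "W + E"]) (simp add: up_closed_plus)
qed

lemma coprime_proportional:
  fixes a b c d :: nat
  assumes "coprime a b" "coprime c d" "b * c = a * d" "a \<ge> 1"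
  shows "c = a \<and> d = b"
proof -
  have "a dvd b * c" "c dvd a * d" using assms(3) by (auto, metis dvd_triv_right)
  then have "a dvd c" "c dvd a"
    using assms(1,2) by (simp_all add: coprime_dvd_mult_right_iff coprime_dvd_mult_left_iff)
  then have "c = a" by (rule dvd_antisym[symmetric])
  then show ?thesis using assms(3,4) by simp
qed

text \<open>
  The point \<open>(M b, M a)\<close> lies on the kink of \<open>min (u a) (v b)\<close>, where the second difference in
  \<open>u\<close> is \<open>- a\<close>. For any other coprime pair \<open>(\<alpha>, \<beta>)\<close> the two arguments of the minimum differ by
  at least \<open>M > \<alpha>\<close> there, so a unit step in \<open>u\<close> does not cross the kink and the second difference
  vanishes. The number \<open>w = M b - 1\<close> is introduced by its successor to keep to natural numbers.
\<close>

lemma second_difference_min: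
  fixes a b \<alpha> \<beta> M w :: nat
  assumes "coprime a b" "coprime \<alpha> \<beta>" "a \<ge> 1" "b \<ge> 1" "\<alpha> < M" and w: "Suc w = M * b"
  shows "min (Suc (Suc w) * \<alpha>) (M * a * \<beta>) + min (w * \<alpha>) (M * a * \<beta>) +
      (if (\<alpha>, \<beta>) = (a, b) then a else 0) = 2 * min (Suc w * \<alpha>) (M * a * \<beta>)"
proof -
  have w\<alpha>: "w * \<alpha> + \<alpha> = M * (b * \<alpha>)"
    using w by (metis mult_Suc add.commute mult.assoc)
  consider "b * \<alpha> = a * \<beta>" | "Suc (b * \<alpha>) \<le> a * \<beta>" | "Suc (a * \<beta>) \<le> b * \<alpha>" by linarith
  then show ?thesis
  proof cases
    case 1
    then have eq: "\<alpha> = a" "\<beta> = b" using coprime_proportional[OF assms(1,2) 1 assms(3)] by auto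
    have "M * a * \<beta> = w * \<alpha> + \<alpha>" using w\<alpha> eq by (simp add: mult_ac)
    then show ?thesis using eq by simp
  next
    case 2
    have "(\<alpha>, \<beta>) \<noteq> (a, b)" using 2 by auto
    moreover have "M * Suc (b * \<alpha>) \<le> M * (a * \<beta>)" using 2 by (rule mult_le_mono2)
    then have "w * \<alpha> + \<alpha> + M \<le> M * a * \<beta>" using w\<alpha> by (simp add: mult.assoc)
    ultimately show ?thesis using \<open>\<alpha> < M\<close> by (auto simp: min_def)
  next
    case 3
    have "(\<alpha>, \<beta>) \<noteq> (a, b)" using 3 by auto
    moreover have "M * Suc (a * \<beta>) \<le> M * (b * \<alpha>)" using 3 by (rule mult_le_mono2)
    then have "M * a * \<beta> + M \<le> w * \<alpha> + \<alpha>" using w\<alpha> by (simp add: mult.assoc)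
    ultimately show ?thesis using \<open>\<alpha> < M\<close> by (auto simp: min_def)
  qed
qed

text \<open>
  The left-hand sum contains the multiplicity of \<open>(a, b)\<close>; everything else in the equation is
  a value of the support function. Hence the ideal determines the multiplicities.
\<close>

lemma multiplicity_from_support:
  fixes \<alpha> \<beta> \<delta> :: "'i \<Rightarrow> nat"
  assumes "finite K" "\<And>k. k \<in> K \<Longrightarrow> coprime (\<alpha> k) (\<beta> k) \<and> \<alpha> k < M"
    and "coprime a b" "a \<ge> 1" "b \<ge> 1" "Suc w = M * b"
  defines "\<Phi> \<equiv> \<lambda>u v. \<Sum>k\<in>K. \<delta> k * min (u * \<alpha> k) (v * \<beta> k)"
  shows "\<Phi> (Suc (Suc w)) (M * a) + \<Phi> w (M * a) + a * (\<Sum>k | k \<in> K \<and> (\<alpha> k, \<beta> k) = (a, b). \<delta> k) =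
    2 * \<Phi> (Suc w) (M * a)"
proof -
  have "a * (\<Sum>k | k \<in> K \<and> (\<alpha> k, \<beta> k) = (a, b). \<delta> k) =
      (\<Sum>k\<in>K. \<delta> k * (if (\<alpha> k, \<beta> k) = (a, b) then a else 0))"
    using assms(1) by (simp add: sum.inter_filter[symmetric] sum_distrib_left mult.commute if_distrib cong: if_cong)
  then have "\<Phi> (Suc (Suc w)) (M * a) + \<Phi> w (M * a) + a * (\<Sum>k | k \<in> K \<and> (\<alpha> k, \<beta> k) = (a, b). \<delta> k) =
      (\<Sum>k\<in>K. \<delta> k * (min (Suc (Suc w) * \<alpha> k) (M * a * \<beta> k) + min (w * \<alpha> k) (M * a * \<beta> k) +
        (if (\<alpha> k, \<beta> k) = (a, b) then a else 0)))"
    by (simp only: \<Phi>_def sum.distrib distrib_left)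
  also have "\<dots> = (\<Sum>k\<in>K. \<delta> k * (2 * min (Suc w * \<alpha> k) (M * a * \<beta> k)))"
    using assms by (intro sum.cong arg_cong2[of _ _ _ _ "(*)"] second_difference_min refl) auto
  also have "\<dots> = 2 * \<Phi> (Suc w) (M * a)"
    by (simp only: \<Phi>_def sum_distrib_left mult.left_commute)
  finally show ?thesis .
qed

text \<open>
  Both factorisations have the same support function, hence the same multiplicity for every coprime
  pair. So the same pairs occur in both, and matching equal pairs defines \<open>\<sigma>\<close>.
\<close>

lemma is_factorisation_unique:
  assumes f: "is_factorisation I t \<alpha> \<beta> \<delta>" and f': "is_factorisation I t' \<alpha>' \<beta>' \<delta>'"
  shows "\<exists>\<sigma>. bij_betw \<sigma> {1..t} {1..t'} \<and>
    (\<forall>k\<in>{1..t}. \<alpha>' (\<sigma> k) = \<alpha> k \<and> \<beta>' (\<sigma> k) = \<beta> k \<and> \<delta>' (\<sigma> k) = \<delta> k)"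
proof -
  have pos: "\<alpha> k \<ge> 1 \<and> \<beta> k \<ge> 1 \<and> \<delta> k \<ge> 1 \<and> coprime (\<alpha> k) (\<beta> k)" if "k \<in> {1..t}" for k
    using f that by (auto simp: is_factorisation_def coprime_iff_gcd_eq_1)
  have pos': "\<alpha>' k \<ge> 1 \<and> \<beta>' k \<ge> 1 \<and> \<delta>' k \<ge> 1 \<and> coprime (\<alpha>' k) (\<beta>' k)" if "k \<in> {1..t'}" for k
    using f' that by (auto simp: is_factorisation_def coprime_iff_gcd_eq_1)
  obtain E where E: "I = monspan E"
    "\<And>u v. support E u v = (\<Sum>k\<in>{1..t}. \<delta> k * min (u * \<alpha> k) (v * \<beta> k))"
    using finprod_nn_eq_monspan[of "{1..t}" \<alpha> \<beta> \<delta>] pos f unfolding is_factorisation_def by auto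
  obtain E' where E': "I = monspan E'"
    "\<And>u v. support E' u v = (\<Sum>k\<in>{1..t'}. \<delta>' k * min (u * \<alpha>' k) (v * \<beta>' k))"
    using finprod_nn_eq_monspan[of "{1..t'}" \<alpha>' \<beta>' \<delta>'] pos' f' unfolding is_factorisation_def by auto
  have "E' = E" using E(1) E'(1) by (simp add: monspan_inject)
  \<comment> \<open>Any common bound on all \<open>\<alpha> k\<close> and \<open>\<alpha>' k\<close> serves as the scale in \<open>multiplicity_from_support\<close>.\<close>
  define M where "M = Suc (sum \<alpha> {1..t} + sum \<alpha>' {1..t'})"
  have M: "\<alpha> k < M" if "k \<in> {1..t}" for k
    using that member_le_sum[of k "{1..t}" \<alpha>] by (simp add: M_def)
  have M': "\<alpha>' k < M" if "k \<in> {1..t'}" for k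
    using that member_le_sum[of k "{1..t'}" \<alpha>'] by (simp add: M_def)
  define g where "g = (\<lambda>k. (\<alpha> k, \<beta> k))"
  define g' where "g' = (\<lambda>k. (\<alpha>' k, \<beta>' k))"
  define D where "D p = (\<Sum>k | k \<in> {1..t} \<and> g k = p. \<delta> k)" for p
  define D' where "D' p = (\<Sum>k | k \<in> {1..t'} \<and> g' k = p. \<delta>' k)" for p
  have D_eq: "D (a, b) = D' (a, b)" if "coprime a b" "a \<ge> 1" "b \<ge> 1" for a b
  proof -
    have w: "Suc (M * b - 1) = M * b" using that by (simp add: M_def)
    let ?w = "M * b - 1"
    have "support E (Suc (Suc ?w)) (M * a) + support E ?w (M * a) + a * D (a, b) =
        2 * support E (Suc ?w) (M * a)"
      unfolding E(2) D_def g_def using pos M that w by (intro multiplicity_from_support) auto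
    moreover have "support E (Suc (Suc ?w)) (M * a) + support E ?w (M * a) + a * D' (a, b) =
        2 * support E (Suc ?w) (M * a)"
      unfolding \<open>E' = E\<close>[symmetric] E'(2) D'_def g'_def using pos' M' that w
      by (intro multiplicity_from_support) auto
    ultimately have "a * D (a, b) = a * D' (a, b)" by linarith
    then show ?thesis using that by simp
  qed
  have inj: "inj_on g {1..t}" "inj_on g' {1..t'}"
    using f f' by (auto simp: is_factorisation_def g_def g'_def)
  have D_g: "D (g k) = \<delta> k" if "k \<in> {1..t}" for k
  proof -
    have "{j. j \<in> {1..t} \<and> g j = g k} = {k}"
      using that inj_onD[OF inj(1)] by blast
    then show ?thesis unfolding D_def by simp
  qed
  have D'_g': "D' (g' k) = \<delta>' k" if "k \<in> {1..t'}" for k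
  proof -
    have "{j. j \<in> {1..t'} \<and> g' j = g' k} = {k}"
      using that inj_onD[OF inj(2)] by blast
    then show ?thesis unfolding D'_def by simp
  qed
  have DD: "D (g k) = D' (g k)" if "k \<in> {1..t}" for k
    unfolding g_def using pos[OF that] by (intro D_eq) auto
  have DD': "D (g' k) = D' (g' k)" if "k \<in> {1..t'}" for k
    unfolding g'_def using pos'[OF that] by (intro D_eq) auto
  have "g ` {1..t} = g' ` {1..t'}"
  proof
    show "g ` {1..t} \<subseteq> g' ` {1..t'}"
    proof (rule image_subsetI)
      fix k assume k: "k \<in> {1..t}"
      then have "D' (g k) \<noteq> 0" using DD[OF k] D_g[OF k] pos[OF k] by simp
      then obtain j where "j \<in> {1..t'}" "g' j = g k"
        unfolding D'_def by (auto elim!: sum.not_neutral_contains_not_neutral)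
      then show "g k \<in> g' ` {1..t'}" by (metis imageI)
    qed
    show "g' ` {1..t'} \<subseteq> g ` {1..t}"
    proof (rule image_subsetI)
      fix k assume k: "k \<in> {1..t'}"
      then have "D (g' k) \<noteq> 0" using DD'[OF k] D'_g'[OF k] pos'[OF k] by simp
      then obtain j where "j \<in> {1..t}" "g j = g' k"
        unfolding D_def by (auto elim!: sum.not_neutral_contains_not_neutral)
      then show "g' k \<in> g ` {1..t}" by (metis imageI)
    qed
  qed
  then have bij: "bij_betw g {1..t} (g' ` {1..t'})" "bij_betw (the_inv_into {1..t'} g') (g' ` {1..t'}) {1..t'}"
    using inj by (auto simp: bij_betw_def intro: inj_on_the_inv_into)
  define \<sigma> where "\<sigma> = the_inv_into {1..t'} g' \<circ> g"
  have \<sigma>: "bij_betw \<sigma> {1..t} {1..t'}" unfolding \<sigma>_def using bij by (rule bij_betw_trans)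
  have g\<sigma>: "g' (\<sigma> k) = g k" if "k \<in> {1..t}" for k
    unfolding \<sigma>_def o_def using bij_betwE[OF bij(1)] that by (intro f_the_inv_into_f inj(2)) blast
  have "\<alpha>' (\<sigma> k) = \<alpha> k \<and> \<beta>' (\<sigma> k) = \<beta> k \<and> \<delta>' (\<sigma> k) = \<delta> k" if k: "k \<in> {1..t}" for k
  proof -
    have "\<sigma> k \<in> {1..t'}" using \<sigma> k by (auto simp: bij_betw_def)
    then have "\<delta>' (\<sigma> k) = \<delta> k" using D'_g'[of "\<sigma> k"] g\<sigma>[OF k] DD[OF k] D_g[OF k] by simp
    moreover have "\<alpha>' (\<sigma> k) = \<alpha> k \<and> \<beta>' (\<sigma> k) = \<beta> k" using g\<sigma>[OF k] by (simp add: g_def g'_def)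
    ultimately show ?thesis by simp
  qed
  then show ?thesis using \<sigma> by blast
qed

theorem corollary6p12:
  fixes I :: "complex poly poly set"
  assumes "I \<in> \<NN>"
  shows "(\<exists>t \<alpha> \<beta> \<delta>. is_factorisation I t \<alpha> \<beta> \<delta> \<and> (\<forall>k\<in>{1..t}. \<nn> (\<alpha> k) (\<beta> k) \<in> \<NN>)) \<and>
    (\<forall>t \<alpha> \<beta> \<delta> t' \<alpha>' \<beta>' \<delta>'.
      is_factorisation I t \<alpha> \<beta> \<delta> \<longrightarrow> is_factorisation I t' \<alpha>' \<beta>' \<delta>' \<longrightarrow>
      (\<exists>\<sigma>. bij_betw \<sigma> {1..t} {1..t'} \<and>
        (\<forall>k\<in>{1..t}. \<alpha>' (\<sigma> k) = \<alpha> k \<and> \<beta>' (\<sigma> k) = \<beta> k \<and> \<delta>' (\<sigma> k) = \<delta> k)))"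
proof (intro conjI allI impI)
  obtain t \<alpha> \<beta> \<delta> where f: "is_factorisation I t \<alpha> \<beta> \<delta>"
    using exists_is_factorisation[OF assms] by blast
  then have "\<forall>k\<in>{1..t}. \<nn> (\<alpha> k) (\<beta> k) \<in> \<NN>"
    by (auto simp: is_factorisation_def intro!: nn_in_NN)
  with f show "\<exists>t \<alpha> \<beta> \<delta>. is_factorisation I t \<alpha> \<beta> \<delta> \<and> (\<forall>k\<in>{1..t}. \<nn> (\<alpha> k) (\<beta> k) \<in> \<NN>)"
    by blast
qed (rule is_factorisation_unique)

end
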